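(* If $G=(V,E)$ is $K_h$-minor-free and $n=|V|$, then any unit $K_n$-flow $F$ in $G$ has $\mathsf{con}_2(F)\geq \frac{n^2}{12h^{3/2}}$ for $n\geq 4h$.
   Context: $G$ is $K_h$-minor-free if the complete graph $K_h$ is not a minor of $G$. For $u,v\in V$, $\mathcal P_{uv}$ is the set of paths in $G$ between $u$ and $v$. A flow is a map $F$ from the set of all paths to $\mathbb R_+$; its vertex congestion at $v$ is $C_F(v)=\sum_{p\ni v}F(p)$ and $\mathsf{con}_2(F)=\left(\sum_{v\in V}C_F(v)^2\right)^{1/2}$. A unit $K_n$-flow is a flow with $\sum_{p\in\mathcal P_{uv}}F(p)=1$ for every pair of distinct $u,v\in V$. *)

theory Defs imports Complex_Main
begin

text \<open>Graphs are pairs of a vertex set and a set of edges, each edge being an unordered pair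
  of distinct vertices.\<close>

type_synonym 'a ugraph = "'a set \<times> 'a set set"

abbreviation vertices :: "'a ugraph \<Rightarrow> 'a set" where "vertices \<equiv> fst"
abbreviation edges :: "'a ugraph \<Rightarrow> 'a set set" where "edges \<equiv> snd"

definition simple_graph :: "'a ugraph \<Rightarrow> bool" where
  "simple_graph G \<longleftrightarrow> finite (vertices G) \<and>
     (\<forall>e\<in>edges G. \<exists>u\<in>vertices G. \<exists>v\<in>vertices G. u \<noteq> v \<and> e = {u, v})"

definition complete_graph :: "'a set \<Rightarrow> 'a ugraph" where
  "complete_graph A = (A, {{u, v} | u v. u \<in> A \<and> v \<in> A \<and> u \<noteq> v})"

definition vertex_path :: "'a ugraph \<Rightarrow> 'a list \<Rightarrow> bool" where
  "vertex_path G xs \<longleftrightarrow> xs \<noteq> [] \<and> distinct xs \<and> set xs \<subseteq> vertices G \<and>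
     (\<forall>i. Suc i < length xs \<longrightarrow> {xs ! i, xs ! Suc i} \<in> edges G)"

definition path_graph :: "'a list \<Rightarrow> 'a ugraph" where
  "path_graph xs = (set xs, {{xs ! i, xs ! Suc i} | i. Suc i < length xs})"

text \<open>Paths are undirected: a path is the subgraph traced by a sequence of distinct vertices, so a
  sequence and its reversal are the same path, and the paths between \<open>u\<close> and \<open>v\<close> are the paths
  between \<open>v\<close> and \<open>u\<close> (lemma \<open>paths_between_commute\<close>). The set of all paths includes
  the single-vertex ones.\<close>

definition paths_between :: "'a ugraph \<Rightarrow> 'a \<Rightarrow> 'a \<Rightarrow> 'a ugraph set" where
  "paths_between G u v = {path_graph xs | xs. vertex_path G xs \<and> hd xs = u \<and> last xs = v}"

definition paths :: "'a ugraph \<Rightarrow> 'a ugraph set" where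
  "paths G = (\<Union>u\<in>vertices G. \<Union>v\<in>vertices G. paths_between G u v)"

definition connected_graph :: "'a ugraph \<Rightarrow> bool" where
  "connected_graph G \<longleftrightarrow> vertices G \<noteq> {} \<and>
     (\<forall>u\<in>vertices G. \<forall>v\<in>vertices G. paths_between G u v \<noteq> {})"

definition induced_subgraph :: "'a ugraph \<Rightarrow> 'a set \<Rightarrow> 'a ugraph" where
  "induced_subgraph G A = (A, {e \<in> edges G. e \<subseteq> A})"

text \<open>\<open>H\<close> is a minor of \<open>G\<close> if there are disjoint connected branch sets \<open>B x\<close> in \<open>G\<close>, one for each
  vertex \<open>x\<close> of \<open>H\<close>, with an edge of \<open>G\<close> between \<open>B x\<close> and \<open>B y\<close> for each edge of \<open>H\<close>.\<close>

definition is_minor :: "'b ugraph \<Rightarrow> 'a ugraph \<Rightarrow> bool" where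
  "is_minor H G \<longleftrightarrow> (\<exists>B :: 'b \<Rightarrow> 'a set.
     (\<forall>x\<in>vertices H. B x \<subseteq> vertices G \<and> connected_graph (induced_subgraph G (B x))) \<and>
     (\<forall>x\<in>vertices H. \<forall>y\<in>vertices H. x \<noteq> y \<longrightarrow> B x \<inter> B y = {}) \<and>
     (\<forall>x y. {x, y} \<in> edges H \<longrightarrow> (\<exists>a\<in>B x. \<exists>b\<in>B y. {a, b} \<in> edges G)))"

definition complete_minor_free :: "nat \<Rightarrow> 'a ugraph \<Rightarrow> bool" where
  "complete_minor_free h G \<longleftrightarrow> \<not> is_minor (complete_graph {..<h}) G"

text \<open>Only the values of a flow on the paths of \<open>G\<close> matter.\<close>

definition is_flow :: "'a ugraph \<Rightarrow> ('a ugraph \<Rightarrow> real) \<Rightarrow> bool" where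
  "is_flow G F \<longleftrightarrow> (\<forall>p\<in>paths G. 0 \<le> F p)"

definition vertex_congestion :: "'a ugraph \<Rightarrow> ('a ugraph \<Rightarrow> real) \<Rightarrow> 'a \<Rightarrow> real" where
  "vertex_congestion G F v = (\<Sum>p\<in>{p \<in> paths G. v \<in> vertices p}. F p)"

definition con2 :: "'a ugraph \<Rightarrow> ('a ugraph \<Rightarrow> real) \<Rightarrow> real" where
  "con2 G F = sqrt (\<Sum>v\<in>vertices G. (vertex_congestion G F v)\<^sup>2)"

text \<open>A unit \<open>K\<^sub>n\<close>-flow, where \<open>n\<close> is the number of vertices of \<open>G\<close>.\<close>

definition unit_complete_flow :: "'a ugraph \<Rightarrow> ('a ugraph \<Rightarrow> real) \<Rightarrow> bool" where
  "unit_complete_flow G F \<longleftrightarrow> is_flow G F \<and>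
     (\<forall>u\<in>vertices G. \<forall>v\<in>vertices G. u \<noteq> v \<longrightarrow> (\<Sum>p\<in>paths_between G u v. F p) = 1)"

lemma path_graph_rev: "path_graph (rev xs) = path_graph xs"
proof -
  have sub: "{{rev ys ! i, rev ys ! Suc i} | i. Suc i < length (rev ys)}
    \<subseteq> {{ys ! i, ys ! Suc i} | i. Suc i < length ys}" for ys :: "'a list"
  proof clarify
    fix i assume i: "Suc i < length (rev ys)"
    let ?j = "length ys - Suc (Suc i)"
    have "rev ys ! i = ys ! Suc ?j" "rev ys ! Suc i = ys ! ?j"
      using i by (simp_all add: rev_nth Suc_diff_Suc)
    then show "\<exists>j. {rev ys ! i, rev ys ! Suc i} = {ys ! j, ys ! Suc j} \<and> Suc j < length ys"
      using i by (intro exI[of _ ?j]) auto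
  qed
  show ?thesis
    unfolding path_graph_def using sub[of xs] sub[of "rev xs"] by (simp add: subset_antisym)
qed

lemma vertex_path_rev: "vertex_path G xs \<Longrightarrow> vertex_path G (rev xs)"
proof -
  assume xs: "vertex_path G xs"
  have "edges (path_graph xs) \<subseteq> edges G"
    using xs by (auto simp: path_graph_def vertex_path_def)
  then have "edges (path_graph (rev xs)) \<subseteq> edges G"
    by (simp add: path_graph_rev)
  then show ?thesis
    using xs by (auto simp: path_graph_def vertex_path_def)
qed

lemma paths_between_commute: "paths_between G u v = paths_between G v u"
proof -
  have "paths_between G a b \<subseteq> paths_between G b a" for a b
  proof
    fix p assume "p \<in> paths_between G a b"
    then obtain xs where "p = path_graph xs" "vertex_path G xs" "hd xs = a" "last xs = b"
      by (auto simp: paths_between_def)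
    then have "p = path_graph (rev xs)" "vertex_path G (rev xs)" "hd (rev xs) = b" "last (rev xs) = a"
      by (simp_all add: path_graph_rev vertex_path_rev hd_rev last_rev)
    then show "p \<in> paths_between G b a"
      unfolding paths_between_def by blast
  qed
  then show ?thesis by blast
qed

lemma finite_paths: "finite (vertices G) \<Longrightarrow> finite (paths G)"
proof -
  assume fin: "finite (vertices G)"
  have "paths G \<subseteq> Pow (vertices G) \<times> Pow (Pow (vertices G))"
    by (fastforce simp: paths_def paths_between_def path_graph_def vertex_path_def
        dest: nth_mem Suc_lessD)
  then show ?thesis
    using fin by (meson finite_Pow_iff finite_SigmaI finite_subset)
qed

end

theory Submission imports Defs "HOL-Library.Disjoint_Sets" begin

text \<open>Choosing one path for every pair of vertices, without increasing the expectation, turns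
  \<open>F\<close> into an integral flow with at most \<open>con2 G F ^ 2\<close> crossings, a crossing being an ordered pair
  of chosen paths that meet although their end pairs are disjoint.  Among any \<open>3 * h\<close> vertices there
  are more than \<open>h\<close> crossings: otherwise, deleting a vertex for each crossing leaves \<open>2 * h\<close> vertices
  without crossings, and these yield a \<open>K\<^sub>h\<close> minor.  Averaging over all sets of \<open>3 * h\<close> vertices gives
  at least \<open>h * (n / (3 * h)) ^ 4\<close> crossings.

  For the minor, split the \<open>2 * h\<close> vertices into rows \<open>a i\<close> and columns \<open>b j\<close>.  In the absence of
  crossings a vertex on several of the paths from \<open>a i\<close> to \<open>b j\<close> belongs to a single row or to a single
  column, so that after contraction each path alternates between nodes of its row and nodes of its
  column.  If apart from the ends there are at least as many column nodes as row nodes, Rado's theorem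
  gives a nonempty set of column nodes, each of which can be handed over to one row, such that the
  row nodes merged in this way make these column nodes superfluous everywhere else.  Repeating this, with
  the roles of rows and columns exchanged if necessary, leaves one node per row and column, a
  \<open>K\<^bsub>h,h\<^esub>\<close> minor, and contracting a perfect matching of it gives \<open>K\<^sub>h\<close>.\<close>

section \<open>Rado's theorem and the rank of a relation\<close>

text \<open>Rado's theorem for a submodular \<open>f\<close> that may exceed 1 on single elements.
  The sets \<open>M d\<close> are shrunk one element at a time while the Hall-type condition
  survives; once all are singletons, the condition for \<open>D\<close> itself is the
  conclusion.\<close>

lemma submodular_transversal:
  fixes f :: "'e set \<Rightarrow> nat" and M :: "'d \<Rightarrow> 'e set"
  assumes mono: "\<And>S T. S \<subseteq> T \<Longrightarrow> T \<subseteq> U \<Longrightarrow> f S \<le> f T"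
    and submod: "\<And>S T. S \<subseteq> U \<Longrightarrow> T \<subseteq> U \<Longrightarrow> f (S \<union> T) + f (S \<inter> T) \<le> f S + f T"
    and empty: "f {} = 0"
    and "finite D" and "finite U" and "\<And>d. d \<in> D \<Longrightarrow> M d \<subseteq> U"
    and "\<And>D'. D' \<subseteq> D \<Longrightarrow> card D' \<le> f (\<Union>(M ` D'))"
  shows "\<exists>t. (\<forall>d\<in>D. t d \<in> M d) \<and> card D \<le> f (t ` D)"
  using assms(6,7)
proof (induction "\<Sum>d\<in>D. card (M d)" arbitrary: M rule: less_induct)
  case less
  note MU = less.prems(1) and hall = less.prems(2)
  have fin: "finite (M d)" if "d \<in> D" for d
    using MU[OF that] \<open>finite U\<close> finite_subset by blast
  have ne: "M d \<noteq> {}" if "d \<in> D" for d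
    using hall[of "{d}"] that empty by auto
  show ?case
  proof (cases "\<exists>d\<in>D. \<exists>a\<in>M d. \<exists>b\<in>M d. a \<noteq> b")
    case False
    then have sing: "M d = {SOME a. a \<in> M d}" if "d \<in> D" for d
    proof -
      have "(SOME a. a \<in> M d) \<in> M d"
        using ne[OF that] by (simp add: some_in_eq)
      then show ?thesis using False that by blast
    qed
    define t where "t d = (SOME a. a \<in> M d)" for d
    have "\<Union>(M ` D) = t ` D"
      using sing by (auto simp: t_def)
    then show ?thesis
      using hall[of D] sing by (intro exI[of _ t]) (auto simp: t_def)
  next
    case True
    then obtain d a b where d: "d \<in> D" "a \<in> M d" "b \<in> M d" "a \<noteq> b" by blast
    \<comment> \<open>Either the Hall-type condition survives the removal of \<open>c\<close> and
      induction applies, or some set violates it. A violating set contains \<open>d\<close>, and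
      removing \<open>d\<close> from it turns the strict inequality into the weak one stated
      here.\<close>
    have reduce: "(\<exists>t. (\<forall>d\<in>D. t d \<in> M d) \<and> card D \<le> f (t ` D)) \<or>
        (\<exists>D'\<subseteq>D - {d}. f (\<Union>(M ` D') \<union> (M d - {c})) \<le> card D')" if c: "c \<in> M d" for c
    proof (cases "\<forall>D'\<subseteq>D. card D' \<le> f (\<Union>((M(d := M d - {c})) ` D'))")
      case True
      have "(\<Sum>x\<in>D. card ((M(d := M d - {c})) x)) < (\<Sum>x\<in>D. card (M x))"
      proof (rule sum_strict_mono_ex1)
        show "\<forall>x\<in>D. card ((M(d := M d - {c})) x) \<le> card (M x)"
          using fin by (auto intro: card_mono)
        show "\<exists>x\<in>D. card ((M(d := M d - {c})) x) < card (M x)"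
          using d(1) c card_Diff1_less[OF fin c] by auto
      qed (rule \<open>finite D\<close>)
      then have "\<exists>t. (\<forall>x\<in>D. t x \<in> (M(d := M d - {c})) x) \<and> card D \<le> f (t ` D)"
        by (rule less.hyps) (use MU True in \<open>auto split: if_splits\<close>)
      then show ?thesis by (metis Diff_iff fun_upd_apply)
    next
      case False
      then obtain D' where D': "D' \<subseteq> D" "f (\<Union>((M(d := M d - {c})) ` D')) < card D'"
        by (meson not_le)
      have "d \<in> D'"
      proof (rule ccontr)
        assume "d \<notin> D'"
        then have "\<Union>((M(d := M d - {c})) ` D') = \<Union>(M ` D')" by auto
        then show False using D' hall[OF D'(1)] by simp
      qed
      then have "(M(d := M d - {c})) ` D' = insert (M d - {c}) (M ` (D' - {d}))"
        by auto
      then have eq: "\<Union>((M(d := M d - {c})) ` D') = \<Union>(M ` (D' - {d})) \<union> (M d - {c})"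
        by auto
      have "card D' = Suc (card (D' - {d}))"
        using \<open>d \<in> D'\<close> D'(1) \<open>finite D\<close> by (metis card_Suc_Diff1 finite_subset)
      then show ?thesis using D' eq by (intro disjI2 exI[of _ "D' - {d}"]) auto
    qed
    \<comment> \<open>If neither \<open>a\<close> nor \<open>b\<close> can be dropped from \<open>M d\<close>, submodularity is violated at the two
      witnesses of this.\<close>
    show ?thesis
    proof (rule ccontr)
      assume no: "\<not> ?thesis"
      obtain P where P: "P \<subseteq> D - {d}" "f (\<Union>(M ` P) \<union> (M d - {a})) \<le> card P"
        using reduce[OF d(2)] no by blast
      obtain Q where Q: "Q \<subseteq> D - {d}" "f (\<Union>(M ` Q) \<union> (M d - {b})) \<le> card Q"
        using reduce[OF d(3)] no by blast
      let ?P = "\<Union>(M ` P) \<union> (M d - {a})" and ?Q = "\<Union>(M ` Q) \<union> (M d - {b})"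
      have PU: "?P \<subseteq> U" and QU: "?Q \<subseteq> U"
        using MU P(1) Q(1) d(1) by blast+
      have finPQ: "finite P" "finite Q"
        using P(1) Q(1) \<open>finite D\<close> by (auto intro: finite_subset)
      \<comment> \<open>Since \<open>a \<noteq> b\<close>, the two punctured copies of
        \<open>M d\<close> together cover it. The union thus serves the extra index
        \<open>d\<close>, and this surplus of 1 is the contradiction.\<close>
      have "?P \<union> ?Q = \<Union>(M ` insert d (P \<union> Q))"
        using d by auto
      moreover have "card (insert d (P \<union> Q)) \<le> f (\<Union>(M ` insert d (P \<union> Q)))"
        by (rule hall) (use P(1) Q(1) d(1) in blast)
      moreover have "card (insert d (P \<union> Q)) = Suc (card (P \<union> Q))"
        using finPQ P(1) Q(1) by (subst card_insert_disjoint) auto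
      moreover have "card (P \<inter> Q) \<le> f (\<Union>(M ` (P \<inter> Q)))"
        by (rule hall) (use P(1) in blast)
      moreover have "f (\<Union>(M ` (P \<inter> Q))) \<le> f (?P \<inter> ?Q)"
        by (rule mono) (use PU in blast)+
      moreover have "card (P \<union> Q) + card (P \<inter> Q) = card P + card Q"
        using finPQ card_Un_Int by metis
      ultimately show False
        using submod[OF PU QU] P(2) Q(2) by simp
    qed
  qed
qed

section \<open>The graphic matroid of a relation\<close>

definition eclosure :: "'v rel \<Rightarrow> 'v rel" where
  "eclosure S = (S \<union> S\<inverse>)\<^sup>*"

text \<open>For \<open>S \<subseteq> V \<times> V\<close> this is the rank in the graphic matroid:
  with the pairs in \<open>S\<close> as edges, the number of vertices minus the number of components
  is the size of a spanning forest.\<close>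

definition rank :: "'v set \<Rightarrow> 'v rel \<Rightarrow> nat" where
  "rank V S = card V - card (V // eclosure S)"

lemma eclosure_refl [simp]: "(x, x) \<in> eclosure S"
  by (simp add: eclosure_def)

lemma eclosure_sym: "(x, y) \<in> eclosure S \<Longrightarrow> (y, x) \<in> eclosure S"
  unfolding eclosure_def
  by (metis converse_Un converse_converse rtrancl_converseD sup_commute)

lemma eclosure_trans: "(x, y) \<in> eclosure S \<Longrightarrow> (y, z) \<in> eclosure S \<Longrightarrow> (x, z) \<in> eclosure S"
  unfolding eclosure_def by (rule rtrancl_trans)

lemma eclosure_base: "(x, y) \<in> S \<Longrightarrow> (x, y) \<in> eclosure S"
  by (auto simp: eclosure_def)

lemma eclosure_least:
  assumes "(x, y) \<in> eclosure S" "equiv UNIV T" "S \<subseteq> T"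
  shows "(x, y) \<in> T"
  using assms(1) unfolding eclosure_def
proof (induction rule: rtrancl_induct)
  case base
  then show ?case using assms(2) by (simp add: equiv_def refl_on_def)
next
  case (step y z)
  then have "(y, z) \<in> T"
    using assms(2,3) by (auto simp: equiv_def sym_def)
  then show ?case
    using step.IH assms(2) by (auto simp: equiv_def dest: transD)
qed

lemma equiv_eclosure: "equiv UNIV (eclosure S)"
  by (auto simp: equiv_def refl_on_def sym_def trans_def intro: eclosure_sym eclosure_trans)

lemma eclosure_mono: "S \<subseteq> T \<Longrightarrow> eclosure S \<subseteq> eclosure T"
  unfolding eclosure_def by (intro rtrancl_mono) auto

text \<open>The right side is already an equivalence containing the enlarged relation, so by
  minimality nothing but the classes of \<open>a\<close> and \<open>b\<close> gets merged.\<close>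

lemma eclosure_insert:
  "eclosure (insert (a, b) S) = eclosure S \<union>
     (eclosure S `` {a, b}) \<times> (eclosure S `` {a, b})" if "(a, b) \<notin> eclosure S"
proof -
  define C where "C = eclosure S `` {a, b}"
  let ?R = "eclosure S \<union> C \<times> C"
  have C: "y \<in> C" if "x \<in> C" "(x, y) \<in> eclosure S \<or> (y, x) \<in> eclosure S" for x y
    using that unfolding C_def by (blast intro: eclosure_trans eclosure_sym)
  have "equiv UNIV ?R"
  proof (rule equivI)
    show "trans ?R"
      by (rule transI) (use C in \<open>blast intro: eclosure_trans\<close>)
  qed (auto simp: refl_on_def sym_def intro: eclosure_sym)
  then have "eclosure (insert (a, b) S) \<subseteq> ?R"
  proof -
    have "insert (a, b) S \<subseteq> ?R"
      using eclosure_base[of _ _ S] eclosure_refl[of _ S] by (auto simp: C_def simp del: eclosure_refl)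
    then show ?thesis
      using eclosure_least[OF _ \<open>equiv UNIV ?R\<close>] by (intro subrelI)
  qed
  moreover have "eclosure S \<subseteq> eclosure (insert (a, b) S)"
    by (rule eclosure_mono) blast
  moreover have ab: "(a, b) \<in> eclosure (insert (a, b) S)"
    by (rule eclosure_base) simp
  moreover have "C \<times> C \<subseteq> eclosure (insert (a, b) S)"
  proof -
    have "(a, x) \<in> eclosure (insert (a, b) S)" if "x \<in> C" for x
      using that ab calculation(2) unfolding C_def by (blast intro: eclosure_trans)
    then show ?thesis by (blast intro: eclosure_trans eclosure_sym)
  qed
  ultimately show ?thesis
    unfolding C_def by blast
qed

text \<open>The two distinct classes of \<open>a\<close> and \<open>b\<close> disappear and their
  union takes their place; all other classes are unchanged.\<close>

lemma card_quotient_insert: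
  assumes "finite V" "a \<in> V" "b \<in> V" "(a, b) \<notin> eclosure S"
  shows "card (V // eclosure S) = Suc (card (V // eclosure (insert (a, b) S)))"
proof -
  define c where "c x = eclosure S `` {x}" for x
  let ?W = "(V // eclosure S) - {c a, c b}"
  have cls: "eclosure (insert (a, b) S) `` {x} =
      (if x \<in> c a \<union> c b then c a \<union> c b else c x)" for x
    unfolding eclosure_insert[OF assms(4)]
    by (auto simp: c_def intro: eclosure_sym eclosure_trans)
  have quot: "X \<in> V // eclosure S \<longleftrightarrow> (\<exists>x\<in>V. X = c x)" for X
    by (auto simp: quotient_def c_def)
  have mem: "y \<in> c x \<longleftrightarrow> (x, y) \<in> eclosure S" for x y
    by (simp add: c_def)
  have eqc: "c x = c y \<longleftrightarrow> (y, x) \<in> eclosure S" for x y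
    using eq_equiv_class_iff[OF equiv_eclosure, of x y S] eclosure_sym[of x y S] eclosure_sym[of y x S]
    unfolding c_def by blast
  have "V // eclosure (insert (a, b) S) = insert (c a \<union> c b) ?W"
  proof (intro equalityI subsetI)
    fix X assume "X \<in> V // eclosure (insert (a, b) S)"
    then obtain x where x: "x \<in> V" "X = eclosure (insert (a, b) S) `` {x}"
      by (auto elim: quotientE)
    then show "X \<in> insert (c a \<union> c b) ?W"
      using eqc[of x a] eqc[of x b] by (auto simp: cls quot mem)
  next
    fix X assume X: "X \<in> insert (c a \<union> c b) ?W"
    show "X \<in> V // eclosure (insert (a, b) S)"
    proof (cases "X = c a \<union> c b")
      case True
      then have "X = eclosure (insert (a, b) S) `` {a}" by (simp add: cls mem)
      then show ?thesis using assms(2) by (simp add: quotientI)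
    next
      case False
      then obtain x where x: "x \<in> V" "X = c x" "X \<noteq> c a" "X \<noteq> c b"
        using X False quot by blast
      then have "X = eclosure (insert (a, b) S) `` {x}"
        using eqc[of x a] eqc[of x b] by (auto simp: cls mem)
      then show ?thesis using x(1) by (simp add: quotientI)
    qed
  qed
  moreover have "c a \<union> c b \<notin> ?W"
  proof
    assume "c a \<union> c b \<in> ?W"
    then obtain x where x: "c a \<union> c b = c x" using quot by auto
    then have "a \<in> c x" "b \<in> c x" using mem[of a a] mem[of b b] by auto
    then have "(x, a) \<in> eclosure S" "(x, b) \<in> eclosure S" by (simp_all add: mem)
    then show False using assms(4) eclosure_trans[OF eclosure_sym] by metis
  qed
  moreover have fin: "finite (V // eclosure S)"
    using assms(1) by (simp add: quotient_def)
  moreover have "card ?W = card (V // eclosure S) - 2"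
  proof -
    have "c a \<noteq> c b" using eqc[of b a] assms(4) by metis
    moreover have "{c a, c b} \<subseteq> V // eclosure S" using assms(2,3) quot by blast
    ultimately show ?thesis by (simp add: card_Diff_subset)
  qed
  moreover have "card (V // eclosure S) \<ge> 2"
  proof -
    have "{c a, c b} \<subseteq> V // eclosure S" using assms(2,3) quot by blast
    moreover have "card {c a, c b} = 2" using eqc[of b a] assms(4) by (metis card_2_iff)
    ultimately show ?thesis using card_mono[OF fin] by metis
  qed
  ultimately show ?thesis by simp
qed

lemma eclosure_insert_redundant: "(a, b) \<in> eclosure S \<Longrightarrow> eclosure (insert (a, b) S) = eclosure S"
proof (rule equalityI)
  assume ab: "(a, b) \<in> eclosure S"
  have "insert (a, b) S \<subseteq> eclosure S"
    using ab eclosure_base by auto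
  then show "eclosure (insert (a, b) S) \<subseteq> eclosure S"
    using eclosure_least[OF _ equiv_eclosure] by (intro subrelI)
qed (intro eclosure_mono subset_insertI)

lemma card_quotient_le: "finite V \<Longrightarrow> card (V // r) \<le> card V"
  unfolding quotient_def by (metis UNION_singleton_eq_range card_image_le)

text \<open>There are never more classes than vertices, so the subtraction in \<open>rank\<close> is
  not truncated, and one class fewer means a rank exactly one higher.\<close>

lemma rank_insert:
  assumes "finite V" "a \<in> V" "b \<in> V"
  shows "rank V (insert (a, b) S) = (if (a, b) \<in> eclosure S then rank V S else Suc (rank V S))"
  using card_quotient_insert[OF assms, of S] card_quotient_le[OF assms(1), of "eclosure S"]
  by (auto simp: rank_def eclosure_insert_redundant)

lemma rank_mono_step:
  assumes "finite V" "finite R" "R \<subseteq> V \<times> V"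
  shows "rank V S \<le> rank V (S \<union> R)"
  using assms(2,3)
  by (induction R rule: finite_induct) (auto simp: rank_insert[OF assms(1)])

lemma rank_mono:
  assumes "finite V" "S \<subseteq> T" "T \<subseteq> V \<times> V"
  shows "rank V S \<le> rank V T"
  using rank_mono_step[OF assms(1), of T S] assms finite_subset[OF assms(3)]
  by (simp add: Un_absorb1 sup.absorb2)

text \<open>A pair of \<open>T\<close> outside the closure would push the rank of \<open>S\<close>
  above that of \<open>T\<close>. This converts the numerical conclusion of Rado's theorem into the
  hypothesis \<open>span\<close> of \<open>grid_model_merge\<close>.\<close>

lemma rank_spans:
  assumes "finite V" "S \<subseteq> T" "T \<subseteq> V \<times> V" "rank V T \<le> rank V S"
  shows "T \<subseteq> eclosure S"
proof
  fix p assume "p \<in> T"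
  obtain a b where p: "p = (a, b)" by fastforce
  show "p \<in> eclosure S"
  proof (rule ccontr)
    assume "p \<notin> eclosure S"
    moreover have ab: "a \<in> V" "b \<in> V" using \<open>p \<in> T\<close> p assms(3) by auto
    ultimately have "rank V (insert (a, b) S) = Suc (rank V S)"
      using p by (simp add: rank_insert[OF assms(1)])
    moreover have "rank V (insert (a, b) S) \<le> rank V T"
      using \<open>p \<in> T\<close> p assms by (intro rank_mono) auto
    ultimately show False using assms(4) by simp
  qed
qed

text \<open>Diminishing returns: a pair that joins two classes of the larger relation also joins two
  classes of the smaller one.\<close>

lemma rank_diminishing:
  assumes "finite V" "finite R" "R \<subseteq> V \<times> V" "S \<subseteq> T"
  shows "rank V (T \<union> R) + rank V S \<le> rank V T + rank V (S \<union> R)"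
  using assms(2,3)
proof (induction R rule: finite_induct)
  case (insert p R)
  obtain a b where p: "p = (a, b)" by fastforce
  have "eclosure (S \<union> R) \<subseteq> eclosure (T \<union> R)"
    using assms(4) by (intro eclosure_mono) auto
  then show ?case
    using insert p rank_insert[OF assms(1), of a b "S \<union> R"] rank_insert[OF assms(1), of a b "T \<union> R"]
    by (auto split: if_splits)
qed simp

lemma rank_submodular:
  assumes "finite V" "S \<subseteq> V \<times> V" "T \<subseteq> V \<times> V"
  shows "rank V (S \<union> T) + rank V (S \<inter> T) \<le> rank V S + rank V T"
proof -
  have "finite T" using assms finite_subset by blast
  then show ?thesis
    \<comment> \<open>Submodularity is diminishing returns for adding \<open>T\<close> to
      \<open>S \<inter> T\<close> and to \<open>S\<close>.\<close>
    using rank_diminishing[OF assms(1) _ assms(3), of "S \<inter> T" S] by (simp add: Un_absorb1 sup.absorb2)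
qed

lemma rank_empty [simp]: "rank V {} = 0"
proof -
  have "V // eclosure {} = (\<lambda>x. {x}) ` V"
    by (auto simp: quotient_def eclosure_def)
  then show ?thesis by (simp add: rank_def card_image)
qed

section \<open>Contracting to a complete bipartite graph\<close>

definition linked :: "'a ugraph \<Rightarrow> 'a set \<Rightarrow> 'a \<Rightarrow> 'a \<Rightarrow> bool" where
  "linked G X = (\<lambda>u v. u \<in> X \<and> v \<in> X \<and> {u, v} \<in> edges G)\<^sup>*\<^sup>*"

text \<open>Reachability replaces the explicit paths of \<open>connected_graph\<close>, which makes
  unions easy to handle; \<open>connected_graph_induced\<close> translates back at the end.\<close>

definition connected_set :: "'a ugraph \<Rightarrow> 'a set \<Rightarrow> bool" where
  "connected_set G X \<longleftrightarrow> X \<noteq> {} \<and> X \<subseteq> vertices G \<and> (\<forall>x\<in>X. \<forall>y\<in>X. linked G X x y)"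

definition touching :: "'a ugraph \<Rightarrow> 'a set \<Rightarrow> 'a set \<Rightarrow> bool" where
  "touching G X Y \<longleftrightarrow> (\<exists>x\<in>X. \<exists>y\<in>Y. {x, y} \<in> edges G)"

lemma touching_sym: "touching G X Y \<Longrightarrow> touching G Y X"
  unfolding touching_def by (metis insert_commute)

lemma linked_refl [simp]: "linked G X x x"
  by (simp add: linked_def)

lemma linked_trans: "linked G X x y \<Longrightarrow> linked G X y z \<Longrightarrow> linked G X x z"
  unfolding linked_def by (rule rtranclp_trans)

lemma linked_sym: "linked G X x y \<Longrightarrow> linked G X y x"
  unfolding linked_def
  by (rule sympD[OF symp_rtranclp]) (auto simp: symp_def insert_commute)

lemma linked_mono: "linked G X x y \<Longrightarrow> X \<subseteq> Y \<Longrightarrow> linked G Y x y"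
  unfolding linked_def by (erule rtranclp_mono[THEN predicate2D, rotated]) auto

lemma linked_edge: "x \<in> X \<Longrightarrow> y \<in> X \<Longrightarrow> {x, y} \<in> edges G \<Longrightarrow> linked G X x y"
  by (simp add: linked_def r_into_rtranclp)

text \<open>A chain of touching sets lifts to a walk: move inside each connected set and cross to
  the next one along a touching edge.\<close>

lemma connected_set_Union:
  assumes "\<And>X. X \<in> \<X> \<Longrightarrow> connected_set G X" "\<X> \<noteq> {}"
    and link: "\<And>X Y. X \<in> \<X> \<Longrightarrow> Y \<in> \<X> \<Longrightarrow>
      (\<lambda>X Y. X \<in> \<X> \<and> Y \<in> \<X> \<and> touching G X Y)\<^sup>*\<^sup>* X Y"
  shows "connected_set G (\<Union>\<X>)"
proof -
  have inner: "linked G (\<Union>\<X>) x y" if "X \<in> \<X>" "x \<in> X" "y \<in> X" for X x y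
    using assms(1)[OF that(1)] that linked_mono[of G X x y "\<Union>\<X>"]
    by (auto simp: connected_set_def)
  have "linked G (\<Union>\<X>) x y" if "X \<in> \<X>" "Y \<in> \<X>" "x \<in> X" "y \<in> Y" for X Y x y
    using link[OF that(1,2)] that(4)
  proof (induction arbitrary: y rule: rtranclp_induct)
    case base
    then show ?case using inner that by blast
  next
    case (step Y W)
    then obtain a b where ab: "a \<in> Y" "b \<in> W" "{a, b} \<in> edges G"
      by (auto simp: touching_def)
    have "linked G (\<Union>\<X>) x a" using step ab by blast
    moreover have "linked G (\<Union>\<X>) a b"
      using ab step by (intro linked_edge) auto
    moreover have "linked G (\<Union>\<X>) b y"
      using inner step ab by blast
    ultimately show ?case by (meson linked_trans)
  qed
  moreover have "\<Union>\<X> \<noteq> {}" "\<Union>\<X> \<subseteq> vertices G"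
    using assms(1,2) by (auto simp: connected_set_def)
  ultimately show ?thesis unfolding connected_set_def by blast
qed

lemma connected_set_Un:
  assumes "connected_set G X" "connected_set G Y" "touching G X Y"
  shows "connected_set G (X \<union> Y)"
proof -
  have "connected_set G (\<Union>{X, Y})"
    using assms touching_sym[OF assms(3)]
    by (intro connected_set_Union) (auto intro: r_into_rtranclp)
  then show ?thesis by simp
qed

lemma connected_graph_induced:
  assumes "connected_set G X"
  shows "connected_graph (induced_subgraph G X)"
proof -
  let ?H = "induced_subgraph G X"
  have "\<exists>xs. vertex_path ?H xs \<and> hd xs = u \<and> last xs = v"
    if "linked G X u v" "v \<in> X" for u v
    using that(1) unfolding linked_def
  proof (induction rule: converse_rtranclp_induct)
    case base
    show ?case
      using that(2) by (intro exI[of _ "[v]"]) (simp add: vertex_path_def induced_subgraph_def)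
  next
    case (step u w)
    then obtain xs where xs: "vertex_path ?H xs" "hd xs = w" "last xs = v" by blast
    show ?case
    proof (cases "u \<in> set xs")
      case True
      \<comment> \<open>Prepending \<open>u\<close> would repeat a vertex; the part of the path that
        starts at \<open>u\<close> serves instead.\<close>
      then obtain ys zs where split: "xs = ys @ u # zs" by (meson split_list)
      have "{(u # zs) ! i, (u # zs) ! Suc i} \<in> edges ?H" if "Suc i < length (u # zs)" for i
      proof -
        have "Suc (length ys + i) < length xs" using that split by simp
        then have "{xs ! (length ys + i), xs ! Suc (length ys + i)} \<in> edges ?H"
          using xs(1) by (simp add: vertex_path_def)
        then show ?thesis using split by (simp add: nth_append)
      qed
      then have "vertex_path ?H (u # zs)"
        using xs(1) split by (auto simp: vertex_path_def)
      then show ?thesis using xs(3) split by (intro exI[of _ "u # zs"]) simp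
    next
      case False
      have "{(u # xs) ! i, (u # xs) ! Suc i} \<in> edges ?H" if "Suc i < length (u # xs)" for i
      proof (cases i)
        case 0
        have "xs ! 0 = w" using xs(1,2) by (metis hd_conv_nth vertex_path_def)
        then show ?thesis using 0 step(1) by (simp add: induced_subgraph_def)
      next
        case (Suc k)
        then show ?thesis using that xs(1) by (simp add: vertex_path_def)
      qed
      then have "vertex_path ?H (u # xs)"
        using xs(1) False step(1) by (auto simp: vertex_path_def induced_subgraph_def)
      then show ?thesis using xs by (intro exI[of _ "u # xs"]) (auto simp: vertex_path_def)
    qed
  qed
  then have "paths_between ?H u v \<noteq> {}" if "u \<in> X" "v \<in> X" for u v
    using assms that unfolding connected_set_def paths_between_def by blast
  then show ?thesis
    using assms by (simp add: connected_graph_def connected_set_def induced_subgraph_def)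
qed

section \<open>Row and column nodes and their merging\<close>

definition alternating :: "'a ugraph \<Rightarrow> 'a set set \<Rightarrow> 'a set set \<Rightarrow> 'a set \<Rightarrow> 'a set \<Rightarrow> bool" where
  "alternating G \<Z> \<Y> X X' \<longleftrightarrow>
     touching G X X' \<and> (X \<in> \<Z> \<and> X' \<in> \<Y> \<or> X \<in> \<Y> \<and> X' \<in> \<Z>)"

text \<open>Every set in \<open>Z i\<close> or \<open>Y j\<close> is a node, a connected set of vertices to be contracted.  Only
  \<open>A i\<close> and \<open>B j\<close> survive as branch sets; the other nodes serve to connect them.\<close>

definition grid_model ::
    "'a ugraph \<Rightarrow> 'i set \<Rightarrow> ('i \<Rightarrow> 'a set set) \<Rightarrow> ('i \<Rightarrow> 'a set) \<Rightarrow>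
     'j set \<Rightarrow> ('j \<Rightarrow> 'a set set) \<Rightarrow> ('j \<Rightarrow> 'a set) \<Rightarrow> bool" where
  "grid_model G I Z A J Y B \<longleftrightarrow>
     finite I \<and> finite J \<and> I \<noteq> {} \<and> J \<noteq> {} \<and>
     finite (\<Union>(Z ` I)) \<and> finite (\<Union>(Y ` J)) \<and>
     (\<forall>X\<in>\<Union>(Z ` I) \<union> \<Union>(Y ` J). connected_set G X) \<and>
     pairwise disjnt (\<Union>(Z ` I) \<union> \<Union>(Y ` J)) \<and>
     \<Union>(Z ` I) \<inter> \<Union>(Y ` J) = {} \<and>
     disjoint_family_on Z I \<and> disjoint_family_on Y J \<and>
     (\<forall>i\<in>I. A i \<in> Z i) \<and> (\<forall>j\<in>J. B j \<in> Y j) \<and>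
     (\<forall>i\<in>I. \<forall>j\<in>J. (alternating G (Z i) (Y j))\<^sup>*\<^sup>* (A i) (B j))"

lemma alternating_swap: "alternating G \<Z> \<Y> = alternating G \<Y> \<Z>"
  by (auto simp: alternating_def fun_eq_iff)

lemma alternating_rtranclp_sym:
  "(alternating G \<Z> \<Y>)\<^sup>*\<^sup>* X X' \<Longrightarrow> (alternating G \<Z> \<Y>)\<^sup>*\<^sup>* X' X"
  by (rule sympD[OF symp_rtranclp]) (auto simp: symp_def alternating_def dest: touching_sym)

lemma grid_model_swap: "grid_model G I Z A J Y B \<Longrightarrow> grid_model G J Y B I Z A"
  unfolding grid_model_def
  by (auto simp: Un_commute Int_commute alternating_swap intro: alternating_rtranclp_sym)

text \<open>The column node \<open>y\<close> is handed over to the row \<open>t y\<close>.  A path of another row that used \<open>y\<close> can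
  bypass it, since by \<open>span\<close> the row nodes before and after \<open>y\<close> have been merged.\<close>

lemma grid_model_merge:
  fixes Z :: "'i \<Rightarrow> 'a set set" and Y :: "'j \<Rightarrow> 'a set set"
  assumes M: "grid_model G I Z A J Y B"
    and D: "D \<subseteq> \<Union>(Y ` J) - B ` J"
    and t: "\<And>y. y \<in> D \<Longrightarrow> t y \<in> I"
    and N: "\<And>i y. N i y = {z \<in> Z i. touching G y z}"
    and S: "S = (\<Union>y\<in>D. N (t y) y \<times> N (t y) y)"
    and span: "\<And>y i. y \<in> D \<Longrightarrow> i \<in> I \<Longrightarrow> N i y \<times> N i y \<subseteq> eclosure S"
  shows "\<exists>Z' A'. grid_model G I Z' A' J (\<lambda>j. Y j - D) B \<and>
    card (\<Union>(Z' ` I)) \<le> card (\<Union>(Z ` I))"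
proof -
  let ?U = "\<Union>(Z ` I)" and ?W = "\<Union>(Y ` J)"
  have conn: "connected_set G X" if "X \<in> ?U \<union> ?W" for X
    using M that unfolding grid_model_def by blast
  have disj: "X = X'" if "X \<in> ?U \<union> ?W" "X' \<in> ?U \<union> ?W" "x \<in> X" "x \<in> X'" for X X' x
    using M that unfolding grid_model_def pairwise_def disjnt_def by blast
  have sep: "?U \<inter> ?W = {}" using M unfolding grid_model_def by blast
  have famZ: "i = k" if "i \<in> I" "k \<in> I" "z \<in> Z i" "z \<in> Z k" for i k z
    using M that unfolding grid_model_def disjoint_family_on_def by blast
  \<comment> \<open>\<open>c z\<close> is the class of row nodes merged with \<open>z\<close>,
    \<open>m z\<close> the set of column nodes of \<open>D\<close> that glue this class together,
    and \<open>w z\<close> the vertex set of the resulting node.\<close>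
  define c where "c z = eclosure S `` {z}" for z
  define m where "m z = {y \<in> D. N (t y) y \<inter> c z \<noteq> {}}" for z
  define w where "w z = \<Union>(c z \<union> m z)" for z
  \<comment> \<open>Pairs in \<open>S\<close> stay within one row, so merging never mixes
    rows.\<close>
  have row: "z' \<in> Z i" if "(z, z') \<in> eclosure S" "z \<in> Z i" "i \<in> I" for z z' i
    using that(1) unfolding eclosure_def
  proof (induction rule: rtrancl_induct)
    case (step x x')
    then obtain y where "y \<in> D" "x \<in> Z (t y)" "x' \<in> Z (t y)"
      by (auto simp: S N)
    then show ?case using famZ[of i "t y" x] step.IH that(3) t by blast
  qed (rule that(2))
  have cU: "c z \<subseteq> ?U" if "z \<in> ?U" for z
    using that row unfolding c_def by blast
  have mW: "m z \<subseteq> D" for z by (auto simp: m_def)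
  have DW: "D \<subseteq> ?W" using D by blast
  have node: "X \<in> ?U \<union> ?W" if "X \<in> c z \<union> m z" "z \<in> ?U" for X z
    using that cU[OF that(2)] mW[of z] DW by blast
  have self: "z \<in> c z" for z by (simp add: c_def)
  have c_eq: "c z = c z'" if "(z, z') \<in> eclosure S" for z z'
    unfolding c_def using that by (blast intro: eclosure_trans eclosure_sym)
  have w_eq: "w z = w z'" if "(z, z') \<in> eclosure S" for z z'
    using c_eq[OF that] by (simp add: w_def m_def)
  \<comment> \<open>A shared column node \<open>X\<close> has all its neighbours in row
    \<open>t X\<close> in one class, so only one merged node absorbs it.\<close>
  have overlap: "(z, z') \<in> eclosure S"
    if z: "z \<in> ?U" "z' \<in> ?U" and x: "x \<in> w z" "x \<in> w z'" for z z' x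
  proof -
    obtain X X' where X: "X \<in> c z \<union> m z" "X' \<in> c z' \<union> m z'" "x \<in> X" "x \<in> X'"
      using x by (auto simp: w_def)
    moreover have "X \<in> ?U \<union> ?W" "X' \<in> ?U \<union> ?W"
      using X(1,2) node z by auto
    ultimately have "X = X'"
      using disj by simp
    show ?thesis
    proof (cases "X \<in> D")
      case True
      then have "X \<notin> c z" "X' \<notin> c z'" using cU[OF z(1)] cU[OF z(2)] DW sep \<open>X = X'\<close> by blast+
      then have "X \<in> m z" "X \<in> m z'" using X \<open>X = X'\<close> by auto
      then obtain a b where ab: "a \<in> N (t X) X" "a \<in> c z" "b \<in> N (t X) X" "b \<in> c z'"
        by (auto simp: m_def)
      then have "(a, b) \<in> eclosure S" using span[OF True t[OF True]] by blast
      then show ?thesis using ab by (auto simp: c_def intro: eclosure_trans eclosure_sym)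
    next
      case False
      then have "X \<in> c z" "X \<in> c z'" using X \<open>X = X'\<close> mW by auto
      then show ?thesis by (auto simp: c_def intro: eclosure_trans eclosure_sym)
    qed
  qed
  have w_conn: "connected_set G (w z)" if z: "z \<in> ?U" for z
    unfolding w_def
  proof (rule connected_set_Union)
    define R where "R = (\<lambda>X Y. X \<in> c z \<union> m z \<and> Y \<in> c z \<union> m z \<and> touching G X Y)"
    have symR: "R\<^sup>*\<^sup>* X Y \<Longrightarrow> R\<^sup>*\<^sup>* Y X" for X Y
      by (rule sympD[OF symp_rtranclp]) (auto simp: symp_def R_def dest: touching_sym)
    \<comment> \<open>Two row nodes related by \<open>S\<close> both touch some \<open>y\<close> in
      \<open>m z\<close>, which supplies the link between them.\<close>
    have from_z: "R\<^sup>*\<^sup>* z z'" if "(z, z') \<in> eclosure S" for z'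
      using that unfolding eclosure_def
    proof (induction rule: rtrancl_induct)
      case (step x x')
      then obtain y where y: "y \<in> D" "x \<in> N (t y) y" "x' \<in> N (t y) y"
        by (auto simp: S)
      have x: "x \<in> c z" using step(1) by (simp add: c_def eclosure_def)
      have "(x, x') \<in> eclosure S" using span[OF y(1) t[OF y(1)]] y by blast
      then have x': "x' \<in> c z" using x by (auto simp: c_def intro: eclosure_trans)
      have "y \<in> m z" using x y by (auto simp: m_def)
      then have "R x y" "R y x'" using x x' y by (auto simp: R_def N dest: touching_sym)
      then show ?case
        using rtranclp.rtrancl_into_rtrancl[OF rtranclp.rtrancl_into_rtrancl[OF step.IH]] by blast
    qed simp
    have "R\<^sup>*\<^sup>* z X" if X: "X \<in> c z \<union> m z" for X
    proof (cases "X \<in> c z")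
      case True
      then show ?thesis using from_z by (simp add: c_def)
    next
      case False
      then obtain a where a: "a \<in> N (t X) X" "a \<in> c z" "X \<in> m z" using X by (auto simp: m_def)
      then have "R a X" by (auto simp: R_def N dest: touching_sym)
      moreover have "R\<^sup>*\<^sup>* z a" using a from_z by (simp add: c_def)
      ultimately show ?thesis using rtranclp.rtrancl_into_rtrancl by metis
    qed
    then have "R\<^sup>*\<^sup>* X X'" if "X \<in> c z \<union> m z" "X' \<in> c z \<union> m z" for X X'
      using that rtranclp_trans[OF symR] by metis
    then show "(\<lambda>X Y. X \<in> c z \<union> m z \<and> Y \<in> c z \<union> m z \<and> touching G X Y)\<^sup>*\<^sup>* X X'"
      if "X \<in> c z \<union> m z" "X' \<in> c z \<union> m z" for X X'
      using that by (simp add: R_def)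
    show "connected_set G X" if "X \<in> c z \<union> m z" for X
      using node[OF that z] by (rule conn)
    show "c z \<union> m z \<noteq> {}" using self by blast
  qed
  have w_ne: "w z \<noteq> {}" if "z \<in> ?U" for z
    using w_conn[OF that] by (simp add: connected_set_def)
  have w_Y: "w z \<inter> y = {}" if "z \<in> ?U" "y \<in> ?W - D" for z y
  proof (rule ccontr)
    assume "w z \<inter> y \<noteq> {}"
    then obtain x X where X: "X \<in> c z \<union> m z" "x \<in> X" "x \<in> y" by (auto simp: w_def)
    moreover have "X \<in> ?U \<union> ?W" "y \<in> ?U \<union> ?W"
      using node[OF X(1) that(1)] that(2) by simp_all
    ultimately have "X = y" using disj by simp
    then show False using X(1) cU[OF that(1)] mW[of z] that(2) sep by blast
  qed
  define Z' where "Z' i = w ` Z i" for i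
  have UZ': "\<Union>(Z' ` I) = w ` ?U" by (auto simp: Z'_def)
  have UY': "(\<Union>j\<in>J. Y j - D) = ?W - D" by auto
  have alt: "(alternating G (Z' i) (Y j - D))\<^sup>*\<^sup>* (w (A i)) (B j)"
    if ij: "i \<in> I" "j \<in> J" for i j
  proof -
    let ?alt = "(alternating G (Z' i) (Y j - D))\<^sup>*\<^sup>*"
    have w_touch: "touching G (w z) y" if "touching G z y" for z y
      using that self[of z] by (auto simp: touching_def w_def)
    have A: "A i \<in> Z i" "A i \<notin> Y j"
      using M ij sep unfolding grid_model_def by blast+
    have path: "(alternating G (Z i) (Y j))\<^sup>*\<^sup>* (A i) (B j)"
      using M ij unfolding grid_model_def by blast
    have "(X \<in> Z i \<and> ?alt (w (A i)) (w X)) \<or>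
        (X \<in> Y j - D \<and> ?alt (w (A i)) X) \<or>
        (X \<in> Y j \<inter> D \<and> (\<exists>z\<in>N i X. ?alt (w (A i)) (w z)))"
      if "(alternating G (Z i) (Y j))\<^sup>*\<^sup>* (A i) X" for X
      using that
    proof (induction rule: rtranclp_induct)
      case base
      then show ?case using A by simp
    next
      case (step X X')
      have notboth: "\<not> (V \<in> Z i \<and> V \<in> Y j)" for V
        using sep ij by blast
      from step(2) consider (to_col) "X \<in> Z i" "X' \<in> Y j" | (to_row) "X \<in> Y j" "X' \<in> Z i"
        by (auto simp: alternating_def)
      then show ?case
      proof cases
        case to_col
        then have IH: "?alt (w (A i)) (w X)" using step.IH notboth by blast
        have touch: "touching G X X'" using step(2) by (simp add: alternating_def)
        show ?thesis
        proof (cases "X' \<in> D")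
          case True
          then show ?thesis using to_col IH touch by (auto simp: N dest: touching_sym)
        next
          case False
          then have "alternating G (Z' i) (Y j - D) (w X) X'"
            using to_col w_touch[OF touch] by (auto simp: alternating_def Z'_def)
          then show ?thesis
            using False to_col IH by (meson DiffI rtranclp.rtrancl_into_rtrancl)
        qed
      next
        case to_row
        have touch: "touching G X X'" using step(2) by (simp add: alternating_def)
        show ?thesis
        proof (cases "X \<in> D")
          case True
          then obtain z where z: "z \<in> N i X" "?alt (w (A i)) (w z)"
            using step.IH to_row notboth by blast
          have "X' \<in> N i X" using to_row touch by (simp add: N)
          then have "w z = w X'" using span[OF True ij(1)] z(1) by (intro w_eq) blast
          then show ?thesis using z to_row by simp
        next
          case False
          then have "?alt (w (A i)) X" using step.IH to_row notboth by blast
          moreover have "alternating G (Z' i) (Y j - D) X (w X')"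
            using False to_row w_touch[OF touching_sym[OF touch]]
            by (auto simp: alternating_def Z'_def dest: touching_sym)
          ultimately show ?thesis
            using to_row by (meson rtranclp.rtrancl_into_rtrancl)
        qed
      qed
    qed
    \<comment> \<open>The end \<open>B j\<close> is neither a row node nor in \<open>D\<close>, so
      only the middle alternative remains.\<close>
    from this[OF path] show ?thesis
      using M ij D sep unfolding grid_model_def by blast
  qed
  have "grid_model G I Z' (\<lambda>i. w (A i)) J (\<lambda>j. Y j - D) B"
    unfolding grid_model_def UZ' UY'
  proof (intro conjI)
    show "finite I" "finite J" "I \<noteq> {}" "J \<noteq> {}" "finite (w ` ?U)" "finite (?W - D)"
      using M unfolding grid_model_def by blast+
    show "\<forall>X\<in>w ` ?U \<union> (?W - D). connected_set G X"
      using conn w_conn by blast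
    show "pairwise disjnt (w ` ?U \<union> (?W - D))"
    proof (rule pairwiseI)
      fix X X' assume X: "X \<in> w ` ?U \<union> (?W - D)" "X' \<in> w ` ?U \<union> (?W - D)" "X \<noteq> X'"
      show "disjnt X X'"
      proof (rule ccontr)
        assume "\<not> disjnt X X'"
        then obtain x where x: "x \<in> X" "x \<in> X'" by (auto simp: disjnt_def)
        consider (ww) z z' where "z \<in> ?U" "z' \<in> ?U" "X = w z" "X' = w z'"
          | (wy) z where "z \<in> ?U" "X = w z" "X' \<in> ?W - D"
          | (yw) z where "z \<in> ?U" "X' = w z" "X \<in> ?W - D"
          | (yy) "X \<in> ?W" "X' \<in> ?W"
          using X(1,2) unfolding Un_iff[of _ "w ` ?U"] image_iff by (metis DiffD1)
        then show False
        proof cases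
          case ww
          then show ?thesis using overlap[of z z' x] w_eq x X(3) by auto
        next
          case wy
          then show ?thesis using w_Y[of z X'] x by auto
        next
          case yw
          then show ?thesis using w_Y[of z X] x by auto
        next
          case yy
          then show ?thesis using disj[of X X' x] x X(3) by auto
        qed
      qed
    qed
    show "w ` ?U \<inter> (?W - D) = {}"
      using w_Y w_ne by blast
    show "disjoint_family_on Z' I"
      unfolding disjoint_family_on_def
    proof (intro ballI impI)
      fix i k assume ik: "i \<in> I" "k \<in> I" "i \<noteq> k"
      show "Z' i \<inter> Z' k = {}"
      proof (rule ccontr)
        assume "Z' i \<inter> Z' k \<noteq> {}"
        then obtain z z' where z: "z \<in> Z i" "z' \<in> Z k" "w z = w z'" by (auto simp: Z'_def)
        moreover obtain x where "x \<in> w z" using w_ne z(1) ik by blast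
        ultimately have "(z, z') \<in> eclosure S" using ik by (intro overlap) auto
        then show False using row famZ ik z by blast
      qed
    qed
    show "disjoint_family_on (\<lambda>j. Y j - D) J"
      using M unfolding grid_model_def disjoint_family_on_def by blast
    show "\<forall>i\<in>I. w (A i) \<in> Z' i"
      using M unfolding grid_model_def Z'_def by blast
    show "\<forall>j\<in>J. B j \<in> Y j - D"
      using M D unfolding grid_model_def by blast
    show "\<forall>i\<in>I. \<forall>j\<in>J. (alternating G (Z' i) (Y j - D))\<^sup>*\<^sup>* (w (A i)) (B j)"
      using alt by blast
  qed
  moreover have "card (\<Union>(Z' ` I)) \<le> card ?U"
    using M unfolding UZ' grid_model_def by (simp add: card_image_le)
  ultimately show ?thesis by blast
qed

lemma card_Union_special:
  assumes "grid_model G I Z A J Y B"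
  shows "card (\<Union>(Z ` I) - A ` I) = card (\<Union>(Z ` I)) - card I"
proof -
  have "inj_on A I"
    using assms unfolding grid_model_def disjoint_family_on_def inj_on_def by (metis disjoint_iff)
  then have "card (A ` I) = card I" by (rule card_image)
  moreover have "A ` I \<subseteq> \<Union>(Z ` I)" "finite I"
    using assms unfolding grid_model_def by auto
  ultimately show ?thesis by (simp add: card_Diff_subset)
qed

text \<open>A set \<open>E\<close> of pairs (column node, row) gets the rank \<open>f E\<close> of
  the relation that joins, for each pair, all neighbours of the node in the row. The total rank is
  at most the number of spare column nodes, so there is a smallest nonempty \<open>D\<close> with
  \<open>f (D \<times> I) \<le> card D\<close>. Its minimality yields the Hall-type condition,
  Rado's theorem picks a row for each node of \<open>D\<close> without loss of rank, and
  \<open>grid_model_merge\<close> then eliminates \<open>D\<close>.\<close>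

lemma grid_model_reduce:
  fixes Z :: "'i \<Rightarrow> 'a set set" and Y :: "'j \<Rightarrow> 'a set set"
  assumes M: "grid_model G I Z A J Y B"
    and le: "card (\<Union>(Z ` I) - A ` I) \<le> card (\<Union>(Y ` J) - B ` J)"
    and ne: "\<Union>(Y ` J) - B ` J \<noteq> {}"
  shows "\<exists>Z' A' Y'. grid_model G I Z' A' J Y' B \<and>
    card (\<Union>(Z' ` I)) + card (\<Union>(Y' ` J)) < card (\<Union>(Z ` I)) + card (\<Union>(Y ` J))"
proof -
  let ?U = "\<Union>(Z ` I)" and ?W = "\<Union>(Y ` J)"
  define N where "N i y = {z \<in> Z i. touching G y z}" for i y
  define Q where "Q e = N (snd e) (fst e) \<times> N (snd e) (fst e)" for e
  define f where "f E = rank ?U (\<Union>(Q ` E))" for E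
  have fin: "finite ?U" "finite ?W" "finite I" "finite J" "I \<noteq> {}"
    using M unfolding grid_model_def by blast+
  have famZ: "i = k" if "i \<in> I" "k \<in> I" "z \<in> Z i" "z \<in> Z k" for i k z
    using M that unfolding grid_model_def disjoint_family_on_def by blast
  have A: "A i \<in> Z i" if "i \<in> I" for i using M that unfolding grid_model_def by blast
  have QU: "\<Union>(Q ` E) \<subseteq> ?U \<times> ?U" if "E \<subseteq> UNIV \<times> I" for E
  proof -
    have "snd e \<in> I" if "e \<in> E" for e using that \<open>E \<subseteq> UNIV \<times> I\<close> by auto
    then show ?thesis by (fastforce simp: Q_def N_def)
  qed
  \<comment> \<open>Joining stays within rows, so at least \<open>card I\<close> classes remain and
    the rank is at most the number of spare row nodes.\<close>
  have f_top: "f ((?W - B ` J) \<times> I) \<le> card (?W - B ` J)"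
  proof -
    let ?S = "\<Union>(Q ` ((?W - B ` J) \<times> I))"
    have row: "z' \<in> Z i" if "(z, z') \<in> eclosure ?S" "z \<in> Z i" "i \<in> I" for z z' i
      using that(1) unfolding eclosure_def
    proof (induction rule: rtrancl_induct)
      case (step x x')
      then obtain k where "k \<in> I" "x \<in> Z k" "x' \<in> Z k"
        by (auto simp: Q_def N_def)
      then show ?case using famZ[of i k x] step.IH that(3) by blast
    qed (rule that(2))
    have "inj_on (\<lambda>i. eclosure ?S `` {A i}) I"
    proof (rule inj_onI)
      fix i k assume ik: "i \<in> I" "k \<in> I" "eclosure ?S `` {A i} = eclosure ?S `` {A k}"
      have "A k \<in> eclosure ?S `` {A k}" by simp
      then have "(A i, A k) \<in> eclosure ?S" using ik(3) by blast
      then have "A k \<in> Z i" using row A ik(1) by blast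
      then show "i = k" using famZ A ik by blast
    qed
    then have "card I = card ((\<lambda>i. eclosure ?S `` {A i}) ` I)" by (simp add: card_image)
    also have "\<dots> \<le> card (?U // eclosure ?S)"
    proof (rule card_mono)
      show "finite (?U // eclosure ?S)" unfolding quotient_def by (rule finite_UN_I[OF fin(1)]) simp
      show "(\<lambda>i. eclosure ?S `` {A i}) ` I \<subseteq> ?U // eclosure ?S"
        using A by (blast intro: quotientI)
    qed
    finally show ?thesis
      using le card_Union_special[OF M] by (simp add: f_def rank_def)
  qed
  define P where "P D \<longleftrightarrow> D \<subseteq> ?W - B ` J \<and> D \<noteq> {} \<and> f (D \<times> I) \<le> card D" for D
  have "P (?W - B ` J)" using f_top ne by (simp add: P_def)
  then obtain D where D: "P D" and least: "\<And>D'. P D' \<Longrightarrow> card D \<le> card D'"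
    using ex_has_least_nat[of P _ card] by blast
  have DW: "D \<subseteq> ?W - B ` J" and Dne: "D \<noteq> {}" and Df: "f (D \<times> I) \<le> card D"
    using D by (auto simp: P_def)
  have finD: "finite D" using DW fin(2) finite_subset by blast
  have small: "card D' < f (D' \<times> I)" if "D' \<subset> D" "D' \<noteq> {}" for D'
  proof -
    have "card D' < card D" using that finD by (simp add: psubset_card_mono)
    then have "\<not> P D'" using least[of D'] by linarith
    moreover have "D' \<subseteq> ?W - B ` J" using that(1) DW by (meson order_trans psubset_imp_subset)
    ultimately show ?thesis using that(2) unfolding P_def by (meson leI)
  qed
  have monof: "f E \<le> f E'" if "E \<subseteq> E'" "E' \<subseteq> D \<times> I" for E E'
    unfolding f_def using that QU[of E'] fin(1) by (intro rank_mono) auto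
  have submodf: "f (E \<union> E') + f (E \<inter> E') \<le> f E + f E'" if "E \<subseteq> D \<times> I" "E' \<subseteq> D \<times> I" for E E'
  proof -
    have QE: "\<Union>(Q ` E) \<subseteq> ?U \<times> ?U" "\<Union>(Q ` E') \<subseteq> ?U \<times> ?U"
      using that by (auto intro!: QU)
    have "rank ?U (\<Union>(Q ` (E \<inter> E'))) \<le> rank ?U (\<Union>(Q ` E) \<inter> \<Union>(Q ` E'))"
      using QE fin(1) by (intro rank_mono) blast+
    then show ?thesis
      using rank_submodular[OF fin(1) QE] by (simp add: f_def Union_Un_distrib image_Un)
  qed
  have "\<exists>t. (\<forall>y\<in>D. t y \<in> {y} \<times> I) \<and> f (D \<times> I) \<le> f (t ` D)"
  \<comment> \<open>With rank 0 any choice of rows keeps the rank. The case is separate because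
    \<open>D\<close> itself then fails the Hall-type condition.\<close>
  proof (cases "f (D \<times> I) = 0")
    case True
    obtain i where "i \<in> I" using fin(5) by blast
    then show ?thesis using True by (intro exI[of _ "\<lambda>y. (y, i)"]) simp
  next
    case False
    have "\<exists>t. (\<forall>y\<in>D. t y \<in> {y} \<times> I) \<and> card D \<le> f (t ` D)"
    proof (rule submodular_transversal[where U = "D \<times> I"])
      show "f {} = 0" by (simp add: f_def)
      show "finite (D \<times> I)" using finD fin(3) by simp
      fix D' assume D': "D' \<subseteq> D"
      have eq: "(\<Union>y\<in>D'. {y} \<times> I) = D' \<times> I" for D' by auto
      have "card D' \<le> f (D' \<times> I)"
      proof (cases "D' = D")
        case True
        \<comment> \<open>For \<open>D\<close> itself, dropping one \<open>y\<close> leaves a proper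
          subset; if it is nonempty, its strict inequality makes up for the missing element.\<close>
        obtain y where y: "y \<in> D" using Dne by blast
        have cD: "card D = Suc (card (D - {y}))" using y finD by (metis card_Suc_Diff1)
        show ?thesis
        proof (cases "D - {y} = {}")
          case True
          then have "card D = 1" using cD by (metis card.empty One_nat_def)
          then show ?thesis using False \<open>D' = D\<close> by simp
        next
          case False
          then have "card (D - {y}) < f ((D - {y}) \<times> I)" using y by (intro small) auto
          also have "\<dots> \<le> f (D \<times> I)" by (intro monof) auto
          finally show ?thesis using cD \<open>D' = D\<close> by simp
        qed
      next
        case False
        then have "D' \<subset> D" using D' by blast
        then show ?thesis using small[of D'] by (cases "D' = {}") auto
      qed
      then show "card D' \<le> f (\<Union>y\<in>D'. {y} \<times> I)" by (simp add: eq)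
    qed (use monof submodf finD in auto)
    then show ?thesis using Df by (meson le_trans)
  qed
  then obtain t where t: "\<And>y. y \<in> D \<Longrightarrow> t y \<in> {y} \<times> I" and ft: "f (D \<times> I) \<le> f (t ` D)" by blast
  define r where "r y = snd (t y)" for y
  have tr: "t y = (y, r y)" "r y \<in> I" if "y \<in> D" for y
    using t[OF that] by (auto simp: r_def)
  have S_eq: "\<Union>(Q ` t ` D) = (\<Union>y\<in>D. N (r y) y \<times> N (r y) y)"
    using tr(1) by (simp add: Q_def)
  \<comment> \<open>The chosen pairs already have the full rank of \<open>D \<times> I\<close>, so
    they span all the joins.\<close>
  have "\<Union>(Q ` (D \<times> I)) \<subseteq> eclosure (\<Union>(Q ` t ` D))"
  proof (rule rank_spans)
    have "t ` D \<subseteq> D \<times> I" using tr by auto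
    then show "\<Union>(Q ` t ` D) \<subseteq> \<Union>(Q ` (D \<times> I))" by (intro Union_mono image_mono)
    show "\<Union>(Q ` (D \<times> I)) \<subseteq> ?U \<times> ?U" by (rule QU) auto
    show "rank ?U (\<Union>(Q ` (D \<times> I))) \<le> rank ?U (\<Union>(Q ` t ` D))" using ft by (simp add: f_def)
  qed (rule fin(1))
  then have span: "N i y \<times> N i y \<subseteq> eclosure (\<Union>y\<in>D. N (r y) y \<times> N (r y) y)"
    if "y \<in> D" "i \<in> I" for i y
    using that unfolding S_eq by (force simp: Q_def)
  obtain Z' A' where Z': "grid_model G I Z' A' J (\<lambda>j. Y j - D) B" "card (\<Union>(Z' ` I)) \<le> card ?U"
    using grid_model_merge[OF M DW tr(2) N_def refl span] by blast
  have "(\<Union>j\<in>J. Y j - D) = ?W - D" by auto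
  moreover have "D \<subseteq> ?W" using DW by (meson Diff_subset order_trans)
  ultimately have "(\<Union>j\<in>J. Y j - D) \<subset> ?W" using Dne by (metis Diff_disjoint Diff_subset inf.absorb_iff2 inf_commute psubsetI)
  then have "card (\<Union>j\<in>J. Y j - D) < card ?W" using fin(2) by (rule psubset_card_mono[rotated])
  then show ?thesis using Z' by (intro exI[of _ Z'] exI[of _ A'] exI[of _ "\<lambda>j. Y j - D"]) simp
qed

text \<open>Induction on the number of nodes. While there are spare nodes, the side with at least as
  many of them loses some by \<open>grid_model_reduce\<close>, after a swap if this is the row side.
  Without spare nodes the special ones already touch.\<close>

lemma grid_model_complete:
  fixes Z :: "'i \<Rightarrow> 'a set set" and Y :: "'j \<Rightarrow> 'a set set"
  assumes "grid_model G I Z A J Y B"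
  shows "\<exists>A' B'. (\<forall>i\<in>I. connected_set G (A' i)) \<and> (\<forall>j\<in>J. connected_set G (B' j)) \<and>
    disjoint_family_on A' I \<and> disjoint_family_on B' J \<and>
    (\<forall>i\<in>I. \<forall>j\<in>J. A' i \<inter> B' j = {} \<and> touching G (A' i) (B' j))"
  using assms
proof (induction "card (\<Union>(Z ` I)) + card (\<Union>(Y ` J))" arbitrary: Z A Y B rule: less_induct)
  case less
  note M = less.prems
  let ?U = "\<Union>(Z ` I)" and ?W = "\<Union>(Y ` J)"
  have fin: "finite ?U" "finite ?W"
    using M unfolding grid_model_def by blast+
  consider "?U - A ` I = {}" "?W - B ` J = {}"
    | "card (?U - A ` I) \<le> card (?W - B ` J)" "?W - B ` J \<noteq> {}"
    | "card (?W - B ` J) \<le> card (?U - A ` I)" "?U - A ` I \<noteq> {}"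
    using fin by (metis card_0_eq finite_Diff le_zero_eq nat_le_linear)
  then show ?case
  proof cases
    case 1
    have AZ: "A i \<in> Z i" if "i \<in> I" for i using M that unfolding grid_model_def by blast
    have BY: "B j \<in> Y j" if "j \<in> J" for j using M that unfolding grid_model_def by blast
    have disj: "X \<inter> X' = {}" if "X \<in> ?U \<union> ?W" "X' \<in> ?U \<union> ?W" "X \<noteq> X'" for X X'
      using M that unfolding grid_model_def pairwise_def disjnt_def by blast
    have sep: "?U \<inter> ?W = {}" using M unfolding grid_model_def by blast
    have famZ: "i = k" if "i \<in> I" "k \<in> I" "z \<in> Z i" "z \<in> Z k" for i k z
      using M that unfolding grid_model_def disjoint_family_on_def by blast
    have famY: "i = k" if "i \<in> J" "k \<in> J" "z \<in> Y i" "z \<in> Y k" for i k z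
      using M that unfolding grid_model_def disjoint_family_on_def by blast
    have Yj: "X = B j" if "j \<in> J" "X \<in> Y j" for j X
    proof -
      have "X \<in> ?W" using that by blast
      then have "X \<in> B ` J" using 1(2) by (metis DiffI empty_iff)
      then obtain k where k: "k \<in> J" "X = B k" by blast
      then show ?thesis using famY[of j k X] that BY[of k] by simp
    qed
    have touch: "touching G (A i) (B j)" if ij: "i \<in> I" "j \<in> J" for i j
    proof -
      have "(alternating G (Z i) (Y j))\<^sup>*\<^sup>* (A i) (B j)"
        using M ij unfolding grid_model_def by blast
      moreover have "A i \<noteq> B j" using AZ BY ij sep by blast
      \<comment> \<open>Steps of the walk only go between row and column nodes, so the first one
        leaves \<open>A i\<close> for a node of \<open>Y j\<close>, and \<open>B j\<close> is the
        only one there.\<close>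
      ultimately obtain X where X: "alternating G (Z i) (Y j) (A i) X"
        by (metis converse_rtranclpE)
      moreover have "A i \<notin> Y j" using AZ ij sep by blast
      ultimately show ?thesis using Yj ij by (auto simp: alternating_def)
    qed
    have "connected_set G (A i)" if "i \<in> I" for i
      using M AZ that unfolding grid_model_def by blast
    moreover have "connected_set G (B j)" if "j \<in> J" for j
      using M BY that unfolding grid_model_def by blast
    moreover have "disjoint_family_on A I"
      unfolding disjoint_family_on_def
    proof (intro ballI impI)
      fix i k assume "i \<in> I" "k \<in> I" "i \<noteq> k"
      then show "A i \<inter> A k = {}" using AZ famZ by (intro disj) (blast, blast, metis)
    qed
    moreover have "disjoint_family_on B J"
      unfolding disjoint_family_on_def
    proof (intro ballI impI)
      fix i k assume "i \<in> J" "k \<in> J" "i \<noteq> k"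
      then show "B i \<inter> B k = {}" using BY famY by (intro disj) (blast, blast, metis)
    qed
    moreover have "A i \<inter> B j = {}" if "i \<in> I" "j \<in> J" for i j
    proof (rule disj)
      have "A i \<in> ?U" "B j \<in> ?W" using AZ[OF that(1)] BY[OF that(2)] that by blast+
      then show "A i \<in> ?U \<union> ?W" "B j \<in> ?U \<union> ?W" "A i \<noteq> B j"
        using sep by (simp, simp, metis disjoint_iff)
    qed
    ultimately show ?thesis using touch by (intro exI[of _ A] exI[of _ B]) blast
  next
    case 2
    obtain Z' A' Y' where "grid_model G I Z' A' J Y' B"
      and "card (\<Union>(Z' ` I)) + card (\<Union>(Y' ` J)) < card ?U + card ?W"
      using grid_model_reduce[OF M 2] by blast
    then show ?thesis using less.hyps by blast
  next
    case 3
    obtain Y' B' Z' where M': "grid_model G J Y' B' I Z' A"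
      and "card (\<Union>(Y' ` J)) + card (\<Union>(Z' ` I)) < card ?W + card ?U"
      using grid_model_reduce[OF grid_model_swap[OF M] 3] by blast
    then show ?thesis using less.hyps[OF _ grid_model_swap[OF M']] by (simp add: add.commute)
  qed
qed

section \<open>From uncrossed paths to minors\<close>

definition component :: "'a ugraph \<Rightarrow> 'a set \<Rightarrow> 'a \<Rightarrow> 'a set" where
  "component G X x = {y. linked G X x y}"

lemma linked_in: "linked G X x y \<Longrightarrow> x \<in> X \<Longrightarrow> y \<in> X"
  unfolding linked_def by (induction rule: rtranclp_induct) auto

lemma component_subset: "x \<in> X \<Longrightarrow> component G X x \<subseteq> X"
  by (auto simp: component_def dest: linked_in)

lemma component_self [simp]: "x \<in> component G X x"
  by (simp add: component_def)

lemma component_eq: "linked G X x y \<Longrightarrow> component G X x = component G X y"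
  by (auto simp: component_def intro: linked_trans linked_sym)

lemma component_overlap:
  "z \<in> component G X x \<Longrightarrow> z \<in> component G X y \<Longrightarrow> component G X x = component G X y"
  by (metis component_def component_eq mem_Collect_eq)

lemma connected_set_component:
  assumes "x \<in> X" "X \<subseteq> vertices G"
  shows "connected_set G (component G X x)"
proof -
  have "linked G (component G X x) x y" if "linked G X x y" for y
    using that unfolding linked_def[of G X]
  proof (induction rule: rtranclp_induct)
    case (step y z)
    then have "linked G X x y" "linked G X x z"
      by (auto simp: linked_def intro: rtranclp.rtrancl_into_rtrancl)
    then have "linked G (component G X x) y z"
      using step(2) by (intro linked_edge) (auto simp: component_def)
    then show ?case using step.IH linked_trans by metis
  qed simp
  then have "linked G (component G X x) x y" if "y \<in> component G X x" for y
    using that unfolding component_def by simp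
  then have "linked G (component G X x) y z"
    if "y \<in> component G X x" "z \<in> component G X x" for y z
    using that linked_trans[OF linked_sym] by metis
  moreover have "component G X x \<noteq> {}" using component_self[of x G X] by blast
  ultimately show ?thesis
    using component_subset[OF assms(1)] assms(2) unfolding connected_set_def by blast
qed

text \<open>Two paths through a common vertex agree in their row or in their column index, so every
  vertex on a path can be assigned to one row or one column. The nodes are the components of the
  resulting sets \<open>R i\<close> and \<open>C j\<close>; contracting them turns each path into an
  alternating walk.\<close>

lemma grid_model_of_paths:
  fixes p :: "'i \<Rightarrow> 'j \<Rightarrow> 'a list" and I :: "'i set" and J :: "'j set"
  assumes "finite I" "finite J" "card I \<ge> 2" "card J \<ge> 2"
    and path: "\<And>i j. i \<in> I \<Longrightarrow> j \<in> J \<Longrightarrow>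
      vertex_path G (p i j) \<and> hd (p i j) = a i \<and> last (p i j) = b j"
    and clean: "\<And>i j k l. \<lbrakk>i \<in> I; j \<in> J; k \<in> I; l \<in> J; i \<noteq> k; j \<noteq> l\<rbrakk> \<Longrightarrow>
      set (p i j) \<inter> set (p k l) = {}"
  shows "\<exists>Z A Y B. grid_model G I Z A J Y B"
proof -
  have other: "\<exists>y\<in>S. y \<noteq> x" if "card S \<ge> 2" for S :: "'b set" and x
    using that card_le_Suc0_iff_eq[of S] by (metis One_nat_def Suc_1 card.infinite not_less_eq_eq zero_le)
  \<comment> \<open>Vertices on a single path count as row vertices, so \<open>C j\<close> excludes them.\<close>
  define R where "R i = {x. (\<exists>j\<in>J. x \<in> set (p i j)) \<and> (\<forall>k\<in>I. \<forall>l\<in>J. x \<in> set (p k l) \<longrightarrow> k = i)}" for i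
  define C where "C j = {x. (\<exists>i\<in>I. x \<in> set (p i j)) \<and> (\<forall>i\<in>I. x \<notin> R i)}" for j
  have on: "x \<in> R i \<union> C j" if "i \<in> I" "j \<in> J" "x \<in> set (p i j)" for i j x
    using that by (auto simp: C_def) (auto simp: R_def)
  have RR: "i = k" if x: "x \<in> R i" "x \<in> R k" "i \<in> I" "k \<in> I" for x i k
  proof -
    obtain j where "j \<in> J" "x \<in> set (p i j)" using x(1) unfolding R_def by blast
    then show ?thesis using x(2,3) unfolding R_def by blast
  qed
  have RC: "x \<notin> C j" if "x \<in> R i" "i \<in> I" for x i j
    using that by (auto simp: C_def)
  have CC: "j = l" if x: "x \<in> C j" "x \<in> C l" and jl: "j \<in> J" "l \<in> J" for x j l
  proof (rule ccontr)
    \<comment> \<open>Paths through \<open>x\<close> in columns \<open>j\<close> and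
      \<open>l\<close> must share a row \<open>i\<close>. As \<open>x\<close> is not in
      \<open>R i\<close>, a path of another row also passes through \<open>x\<close>, and it would
      have to lie in both columns.\<close>
    assume "j \<noteq> l"
    obtain i where i: "i \<in> I" "x \<in> set (p i j)" using x by (auto simp: C_def)
    obtain i' where i': "i' \<in> I" "x \<in> set (p i' l)" using x by (auto simp: C_def)
    have "i' = i" using clean[of i j i' l] i i' jl \<open>j \<noteq> l\<close> by blast
    have "x \<notin> R i" using x i by (auto simp: C_def)
    then obtain k m where km: "k \<in> I" "m \<in> J" "x \<in> set (p k m)" "k \<noteq> i"
      using i jl by (auto simp: R_def)
    then have "m = j" "m = l"
      using clean[of k m i j] clean[of k m i l] i i' \<open>i' = i\<close> jl by blast+
    then show False using \<open>j \<noteq> l\<close> by simp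
  qed
  have ne: "p i j \<noteq> []" if "i \<in> I" "j \<in> J" for i j
    using path[OF that] by (simp add: vertex_path_def)
  have aR: "a i \<in> R i" if i: "i \<in> I" for i
  proof -
    have a: "a i \<in> set (p i j)" if "j \<in> J" for j
      using path[OF i that] ne[OF i that] by (metis hd_in_set)
    have "k = i" if "k \<in> I" "l \<in> J" "a i \<in> set (p k l)" for k l
    proof (rule ccontr)
      assume "k \<noteq> i"
      \<comment> \<open>A second column provides a path from \<open>a i\<close> that differs from
        \<open>p k l\<close> in both indices.\<close>
      obtain j where "j \<in> J" "j \<noteq> l" using other[OF assms(4)] by blast
      then show False using clean[of i j k l] that a i \<open>k \<noteq> i\<close> by blast
    qed
    moreover obtain j where "j \<in> J" using assms(4) by fastforce
    ultimately show ?thesis using a by (auto simp: R_def)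
  qed
  have bC: "b j \<in> C j" if j: "j \<in> J" for j
  proof -
    have b: "b j \<in> set (p i j)" if "i \<in> I" for i
      using path[OF that j] ne[OF that j] by (metis last_in_set)
    \<comment> \<open>All paths of column \<open>j\<close> contain \<open>b j\<close>, and they come
      from at least two rows.\<close>
    have "b j \<notin> R i" if "i \<in> I" for i
    proof -
      obtain k where "k \<in> I" "k \<noteq> i" using other[OF assms(3)] by blast
      then show ?thesis using b j by (auto simp: R_def)
    qed
    moreover obtain i where "i \<in> I" using assms(3) by fastforce
    ultimately show ?thesis using b by (auto simp: C_def)
  qed
  have inV: "set (p i j) \<subseteq> vertices G" if "i \<in> I" "j \<in> J" for i j
    using path[OF that] by (simp add: vertex_path_def)
  have RV: "R i \<subseteq> vertices G" "finite (R i)" if "i \<in> I" for i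
  proof -
    have sub: "R i \<subseteq> (\<Union>j\<in>J. set (p i j))" by (auto simp: R_def)
    show "R i \<subseteq> vertices G" using sub inV[OF that] by blast
    show "finite (R i)" by (rule finite_subset[OF sub]) (use assms(2) in simp)
  qed
  have CV: "C j \<subseteq> vertices G" "finite (C j)" if "j \<in> J" for j
  proof -
    have sub: "C j \<subseteq> (\<Union>i\<in>I. set (p i j))" by (auto simp: C_def)
    show "C j \<subseteq> vertices G" using sub inV[OF _ that] by blast
    show "finite (C j)" by (rule finite_subset[OF sub]) (use assms(1) in simp)
  qed
  define Z where "Z i = component G (R i) ` R i" for i
  define Y where "Y j = component G (C j) ` C j" for j
  define A where "A i = component G (R i) (a i)" for i
  define B where "B j = component G (C j) (b j)" for j
  have ZR: "X \<subseteq> R i \<and> X \<noteq> {} \<and> connected_set G X" if "X \<in> Z i" "i \<in> I" for X i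
  proof -
    obtain x where x: "x \<in> R i" "X = component G (R i) x" using \<open>X \<in> Z i\<close> unfolding Z_def by blast
    show ?thesis
      using connected_set_component[OF x(1) RV(1)[OF \<open>i \<in> I\<close>]] component_subset[OF x(1)] x(2)
      by (simp add: connected_set_def)
  qed
  have YC: "X \<subseteq> C j \<and> X \<noteq> {} \<and> connected_set G X" if "X \<in> Y j" "j \<in> J" for X j
  proof -
    obtain x where x: "x \<in> C j" "X = component G (C j) x" using \<open>X \<in> Y j\<close> unfolding Y_def by blast
    show ?thesis
      using connected_set_component[OF x(1) CV(1)[OF \<open>j \<in> J\<close>]] component_subset[OF x(1)] x(2)
      by (simp add: connected_set_def)
  qed
  have alt: "(alternating G (Z i) (Y j))\<^sup>*\<^sup>* (A i) (B j)" if ij: "i \<in> I" "j \<in> J" for i j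
  proof -
    let ?q = "p i j"
    define node where "node x = (if x \<in> R i then component G (R i) x else component G (C j) x)" for x
    have "(alternating G (Z i) (Y j))\<^sup>*\<^sup>* (A i) (node (?q ! k))" if "k < length ?q" for k
      using that
    proof (induction k)
      case 0
      have "?q ! 0 = a i" using path[OF ij] ne[OF ij] by (metis hd_conv_nth)
      then show ?case using aR[OF ij(1)] by (simp add: node_def A_def)
    next
      case (Suc k)
      let ?x = "?q ! k" and ?y = "?q ! Suc k"
      have IH: "(alternating G (Z i) (Y j))\<^sup>*\<^sup>* (A i) (node ?x)" using Suc by simp
      have e: "{?x, ?y} \<in> edges G"
        using path[OF ij] Suc.prems by (simp add: vertex_path_def)
      have x: "?x \<in> R i \<union> C j" and y: "?y \<in> R i \<union> C j"
        using Suc.prems on[OF ij] by (simp_all add: nth_mem)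
      have x_node: "?x \<in> node ?x" "?y \<in> node ?y" by (simp_all add: node_def)
      then have touch: "touching G (node ?x) (node ?y)" using e by (auto simp: touching_def)
      \<comment> \<open>Consecutive vertices of the same kind lie in one component and contract to
        the same node; otherwise the walk takes an alternating step.\<close>
      have same: "node ?x = node ?y \<or> alternating G (Z i) (Y j) (node ?x) (node ?y)"
      proof (cases "?x \<in> R i"; cases "?y \<in> R i")
        assume "?x \<in> R i" "?y \<in> R i"
        then show ?thesis using component_eq[OF linked_edge[OF _ _ e]] by (simp add: node_def)
      next
        assume "?x \<notin> R i" "?y \<notin> R i"
        then show ?thesis using x y component_eq[OF linked_edge[OF _ _ e]] by (simp add: node_def)
      next
        assume "?x \<in> R i" "?y \<notin> R i"
        then have "node ?x \<in> Z i" "node ?y \<in> Y j" using y by (auto simp: node_def Z_def Y_def)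
        then show ?thesis using touch by (simp add: alternating_def)
      next
        assume "?x \<notin> R i" "?y \<in> R i"
        then have "node ?y \<in> Z i" "node ?x \<in> Y j" using x by (auto simp: node_def Z_def Y_def)
        then show ?thesis using touch by (simp add: alternating_def)
      qed
      then show ?case using IH by (metis rtranclp.rtrancl_into_rtrancl)
    qed
    from this[of "length ?q - 1"] have "(alternating G (Z i) (Y j))\<^sup>*\<^sup>* (A i) (node (last ?q))"
      using ne[OF ij] by (simp add: last_conv_nth)
    moreover have "node (b j) = B j"
      using bC[OF ij(2)] RC ij by (auto simp: node_def B_def)
    ultimately show ?thesis using path[OF ij] by simp
  qed
  have ZY: "X \<inter> X' = {}" if "X \<in> Z i" "X' \<in> Y j" "i \<in> I" "j \<in> J" for X X' i j
    using ZR[OF that(1,3)] YC[OF that(2,4)] RC[OF _ that(3)] by blast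
  have ZZ: "X = X' \<and> i = k" if "X \<in> Z i" "X' \<in> Z k" "i \<in> I" "k \<in> I" "x \<in> X" "x \<in> X'" for X X' i k x
  proof -
    have "i = k" using ZR[OF that(1,3)] ZR[OF that(2,4)] RR that by blast
    moreover obtain y y' where "X = component G (R i) y" "X' = component G (R k) y'"
      using \<open>X \<in> Z i\<close> \<open>X' \<in> Z k\<close> unfolding Z_def by blast
    ultimately show ?thesis using that(5,6) component_overlap by metis
  qed
  have YY: "X = X' \<and> i = k" if "X \<in> Y i" "X' \<in> Y k" "i \<in> J" "k \<in> J" "x \<in> X" "x \<in> X'" for X X' i k x
  proof -
    have "i = k" using YC[OF that(1,3)] YC[OF that(2,4)] CC that by blast
    moreover obtain y y' where "X = component G (C i) y" "X' = component G (C k) y'"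
      using \<open>X \<in> Y i\<close> \<open>X' \<in> Y k\<close> unfolding Y_def by blast
    ultimately show ?thesis using that(5,6) component_overlap by metis
  qed
  have "grid_model G I Z A J Y B"
    unfolding grid_model_def
  proof (intro conjI)
    show "finite I" "finite J" "I \<noteq> {}" "J \<noteq> {}" using assms(1-4) by auto
    show "finite (\<Union> (Z ` I))" using assms(1) RV by (simp add: Z_def)
    show "finite (\<Union> (Y ` J))" using assms(2) CV by (simp add: Y_def)
    show "\<forall>X\<in>\<Union> (Z ` I) \<union> \<Union> (Y ` J). connected_set G X" using ZR YC by blast
    show "pairwise disjnt (\<Union> (Z ` I) \<union> \<Union> (Y ` J))"
    proof (rule pairwiseI)
      fix X X' assume X: "X \<in> \<Union> (Z ` I) \<union> \<Union> (Y ` J)" "X' \<in> \<Union> (Z ` I) \<union> \<Union> (Y ` J)" "X \<noteq> X'"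
      show "disjnt X X'"
      proof (rule ccontr)
        assume "\<not> disjnt X X'"
        then obtain x where x: "x \<in> X" "x \<in> X'" by (auto simp: disjnt_def)
        consider "X \<in> \<Union> (Z ` I)" "X' \<in> \<Union> (Z ` I)" | "X \<in> \<Union> (Z ` I)" "X' \<in> \<Union> (Y ` J)"
          | "X' \<in> \<Union> (Z ` I)" "X \<in> \<Union> (Y ` J)" | "X \<in> \<Union> (Y ` J)" "X' \<in> \<Union> (Y ` J)"
          using X(1,2) unfolding Un_iff by metis
        then show False
        proof cases
          case 1
          then obtain i k where "i \<in> I" "k \<in> I" "X \<in> Z i" "X' \<in> Z k" by blast
          then show ?thesis using ZZ x X(3) by metis
        next
          case 2
          then show ?thesis using ZY x by blast
        next
          case 3
          then show ?thesis using ZY x by blast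
        next
          case 4
          then obtain i k where "i \<in> J" "k \<in> J" "X \<in> Y i" "X' \<in> Y k" by blast
          then show ?thesis using YY x X(3) by metis
        qed
      qed
    qed
    show "\<Union> (Z ` I) \<inter> \<Union> (Y ` J) = {}"
    proof -
      have False if "X \<in> Z i" "i \<in> I" "X \<in> Y j" "j \<in> J" for X i j
        using ZY[OF that(1,3,2,4)] ZR[OF that(1,2)] by simp
      then show ?thesis by fastforce
    qed
    show "disjoint_family_on Z I"
    proof -
      have False if "X \<in> Z i" "X \<in> Z k" "i \<in> I" "k \<in> I" "i \<noteq> k" for X i k
        using ZR[OF that(1,3)] ZZ[OF that(1,2,3,4)] that(5) by blast
      then show ?thesis unfolding disjoint_family_on_def by fastforce
    qed
    show "disjoint_family_on Y J"
    proof -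
      have False if "X \<in> Y i" "X \<in> Y k" "i \<in> J" "k \<in> J" "i \<noteq> k" for X i k
        using YC[OF that(1,3)] YY[OF that(1,2,3,4)] that(5) by blast
      then show ?thesis unfolding disjoint_family_on_def by fastforce
    qed
    show "\<forall>i\<in>I. A i \<in> Z i" using aR by (auto simp: A_def Z_def)
    show "\<forall>j\<in>J. B j \<in> Y j" using bC by (auto simp: B_def Y_def)
    show "\<forall>i\<in>I. \<forall>j\<in>J. (alternating G (Z i) (Y j))\<^sup>*\<^sup>* (A i) (B j)" using alt by blast
  qed
  then show ?thesis by blast
qed

text \<open>The contacts of \<open>A i\<close> with \<open>B i\<close> make the branch sets
  \<open>A i \<union> B i\<close> connected; the other contacts supply the edges of
  \<open>K_h\<close>.\<close>

lemma complete_minor_of_grid_model: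
  assumes "grid_model G {..<h} Z A {..<h} Y B"
  shows "is_minor (complete_graph {..<h}) G"
proof -
  obtain A B where AB: "\<And>i. i < h \<Longrightarrow> connected_set G (A i)" "\<And>j. j < h \<Longrightarrow> connected_set G (B j)"
      "disjoint_family_on A {..<h}" "disjoint_family_on B {..<h}"
      "\<And>i j. i < h \<Longrightarrow> j < h \<Longrightarrow> A i \<inter> B j = {} \<and> touching G (A i) (B j)"
    using grid_model_complete[OF assms] by (metis lessThan_iff)
  have conn: "connected_set G (A i \<union> B i)" if "i < h" for i
    using AB that by (intro connected_set_Un) auto
  have "(A i \<union> B i) \<inter> (A j \<union> B j) = {}" if "i < h" "j < h" "i \<noteq> j" for i j
  proof -
    have "A i \<inter> A j = {}" "B i \<inter> B j = {}"
      using AB(3,4) that by (auto simp: disjoint_family_on_def)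
    moreover have "A i \<inter> B j = {}" "A j \<inter> B i = {}" using AB(5) that by auto
    ultimately show ?thesis by blast
  qed
  moreover have "\<exists>a\<in>A x \<union> B x. \<exists>b\<in>A y \<union> B y. {a, b} \<in> edges G"
    if "{x, y} \<in> edges (complete_graph {..<h})" for x y
  proof -
    have "x < h" "y < h" using that by (auto simp: complete_graph_def doubleton_eq_iff)
    then show ?thesis using AB(5)[of x y] by (auto simp: touching_def)
  qed
  moreover have "A i \<union> B i \<subseteq> vertices G \<and> connected_graph (induced_subgraph G (A i \<union> B i))"
    if "i < h" for i
    using conn[OF that] connected_graph_induced[OF conn[OF that]] by (simp add: connected_set_def)
  ultimately show ?thesis
    unfolding is_minor_def
    by (intro exI[of _ "\<lambda>i. A i \<union> B i"]) (auto simp: complete_graph_def)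
qed

lemma complete_minor_of_uncrossed_paths:
  fixes G :: "'a ugraph"
  assumes "h \<ge> 2" "finite T" "card T = 2 * h"
    and path: "\<And>u v. u \<in> T \<Longrightarrow> v \<in> T \<Longrightarrow> u \<noteq> v \<Longrightarrow> f {u, v} \<in> paths_between G u v"
    and clean: "\<And>e e'. \<lbrakk>e \<subseteq> T; e' \<subseteq> T; card e = 2; card e' = 2; e \<inter> e' = {}\<rbrakk> \<Longrightarrow>
      vertices (f e) \<inter> vertices (f e') = {}"
  shows "is_minor (complete_graph {..<h}) G"
proof -
  \<comment> \<open>The first \<open>h\<close> numbers index the rows and the last \<open>h\<close>
    the columns; only paths between the two halves are used.\<close>
  obtain g where g: "bij_betw g {..<2 * h} T"
    using ex_bij_betw_nat_finite[OF assms(2)] assms(3) by (metis atLeast0LessThan)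
  have gT: "g i \<in> T" if "i < 2 * h" for i using g that by (auto simp: bij_betw_def)
  have ginj: "g i = g j \<longleftrightarrow> i = j" if "i < 2 * h" "j < 2 * h" for i j
    using g that by (auto simp: bij_betw_def inj_on_def)
  have ex: "\<exists>xs. path_graph xs = f {g i, g (h + j)} \<and> vertex_path G xs \<and> hd xs = g i \<and> last xs = g (h + j)"
    if "i < h" "j < h" for i j
    using path[of "g i" "g (h + j)"] that gT[of i] gT[of "h + j"] ginj[of i "h + j"]
    by (auto simp: paths_between_def)
  \<comment> \<open>An unoriented path is represented by a vertex sequence running from its row end
    to its column end.\<close>
  define p where "p i j = (SOME xs. path_graph xs = f {g i, g (h + j)} \<and> vertex_path G xs \<and>
    hd xs = g i \<and> last xs = g (h + j))" for i j
  have p: "path_graph (p i j) = f {g i, g (h + j)} \<and>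
      vertex_path G (p i j) \<and> hd (p i j) = g i \<and> last (p i j) = g (h + j)" if "i < h" "j < h" for i j
    unfolding p_def by (rule someI_ex[OF ex[OF that]])
  have vp: "set (p i j) = vertices (f {g i, g (h + j)})" if "i < h" "j < h" for i j
  proof -
    have "vertices (path_graph (p i j)) = set (p i j)" by (simp add: path_graph_def)
    then show ?thesis using p[OF that] by simp
  qed
  have "\<exists>Z A Y B. grid_model G {..<h} Z A {..<h} Y B"
  proof (rule grid_model_of_paths)
    show "vertex_path G (p i j) \<and> hd (p i j) = g i \<and> last (p i j) = g (h + j)"
      if "i \<in> {..<h}" "j \<in> {..<h}" for i j
      using p that by simp
    show "set (p i j) \<inter> set (p k l) = {}"
      if "i \<in> {..<h}" "j \<in> {..<h}" "k \<in> {..<h}" "l \<in> {..<h}" "i \<noteq> k" "j \<noteq> l" for i j k l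
    proof -
      have lt: "i < 2 * h" "h + j < 2 * h" "k < 2 * h" "h + l < 2 * h" using that by auto
      have neq: "g i \<noteq> g (h + j)" "g k \<noteq> g (h + l)" "g i \<noteq> g k" "g i \<noteq> g (h + l)"
          "g (h + j) \<noteq> g k" "g (h + j) \<noteq> g (h + l)"
        using that ginj lt by auto
      have "vertices (f {g i, g (h + j)}) \<inter> vertices (f {g k, g (h + l)}) = {}"
        by (rule clean) (use gT lt neq in \<open>auto simp: card_2_iff\<close>)
      then show ?thesis using vp that by simp
    qed
  qed (use assms(1) in auto)
  then show ?thesis using complete_minor_of_grid_model by blast
qed

section \<open>Counting crossings\<close>

definition crossings :: "('a set \<Rightarrow> 'a ugraph) \<Rightarrow> 'a set \<Rightarrow> ('a set \<times> 'a set) set" where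
  "crossings f S = {(e, e'). e \<subseteq> S \<and> e' \<subseteq> S \<and> card e = 2 \<and> card e' = 2 \<and> e \<inter> e' = {} \<and>
     vertices (f e) \<inter> vertices (f e') \<noteq> {}}"

lemma finite_crossings: "finite S \<Longrightarrow> finite (crossings f S)"
  by (rule finite_subset[of _ "Pow S \<times> Pow S"]) (auto simp: crossings_def)

lemma card_crossings_ge:
  fixes G :: "'a ugraph"
  assumes "h \<ge> 2" "complete_minor_free h G" "finite S"
    and path: "\<And>u v. u \<in> S \<Longrightarrow> v \<in> S \<Longrightarrow> u \<noteq> v \<Longrightarrow> f {u, v} \<in> paths_between G u v"
  shows "card S < card (crossings f S) + 2 * h"
proof (rule ccontr)
  assume "\<not> ?thesis"
  then have le: "card (crossings f S) + 2 * h \<le> card S" by simp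
  \<comment> \<open>One end of the first pair is taken from each crossing, so no crossing survives
    inside \<open>S - R\<close>.\<close>
  define R where "R = (\<lambda>c. SOME x. x \<in> fst c) ` crossings f S"
  have "card R \<le> card (crossings f S)"
    unfolding R_def by (rule card_image_le[OF finite_crossings[OF assms(3)]])
  moreover have "finite R" unfolding R_def using finite_crossings[OF assms(3)] by simp
  ultimately have "2 * h \<le> card (S - R)"
    using le diff_card_le_card_Diff[of R S] by linarith
  then obtain T where T: "T \<subseteq> S - R" "card T = 2 * h" "finite T"
    using obtain_subset_with_card_n by metis
  have "is_minor (complete_graph {..<h}) G"
  proof (rule complete_minor_of_uncrossed_paths[OF assms(1) T(3,2)])
    show "f {u, v} \<in> paths_between G u v" if "u \<in> T" "v \<in> T" "u \<noteq> v" for u v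
      using path that T(1) by blast
    show "vertices (f e) \<inter> vertices (f e') = {}"
      if e: "e \<subseteq> T" "e' \<subseteq> T" "card e = 2" "card e' = 2" "e \<inter> e' = {}" for e e'
    proof (rule ccontr)
      assume "vertices (f e) \<inter> vertices (f e') \<noteq> {}"
      then have "(e, e') \<in> crossings f S" using e T(1) by (auto simp: crossings_def)
      then have "(SOME x. x \<in> e) \<in> R" unfolding R_def by (metis fst_conv image_eqI)
      moreover have "e \<noteq> {}" using e(3) by auto
      then have "(SOME x. x \<in> e) \<in> e" by (simp add: some_in_eq)
      ultimately show False using e(1) T(1) by blast
    qed
  qed
  then show False using assms(2) by (simp add: complete_minor_free_def)
qed

section \<open>Averaging and congestion\<close>

lemma card_subsets_containing:
  assumes "finite V" "X \<subseteq> V" "card X \<le> m"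
  shows "card {S. S \<subseteq> V \<and> card S = m \<and> X \<subseteq> S} = (card V - card X) choose (m - card X)"
proof -
  have finX: "finite X" using assms(1,2) finite_subset by blast
  have "bij_betw (\<lambda>T. T \<union> X) {T. T \<subseteq> V - X \<and> card T = m - card X}
      {S. S \<subseteq> V \<and> card S = m \<and> X \<subseteq> S}"
  proof (rule bij_betw_byWitness[where f' = "\<lambda>S. S - X"])
    show "(\<lambda>T. T \<union> X) ` {T. T \<subseteq> V - X \<and> card T = m - card X}
        \<subseteq> {S. S \<subseteq> V \<and> card S = m \<and> X \<subseteq> S}"
    proof clarify
      fix T assume T: "T \<subseteq> V - X" "card T = m - card X"
      then have "finite T" using assms(1) finite_subset by blast
      then have "card (T \<union> X) = m" using T finX assms(3) by (subst card_Un_disjoint) auto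
      then show "T \<union> X \<subseteq> V \<and> card (T \<union> X) = m \<and> X \<subseteq> T \<union> X" using T assms(2) by blast
    qed
    show "(\<lambda>S. S - X) ` {S. S \<subseteq> V \<and> card S = m \<and> X \<subseteq> S} \<subseteq> {T. T \<subseteq> V - X \<and> card T = m - card X}"
      using finX by (auto simp: card_Diff_subset)
  qed auto
  then show ?thesis
    using n_subsets[of "V - X" "m - card X"] assms(1) finX card_Diff_subset[OF finX assms(2)]
    by (simp add: bij_betw_same_card)
qed

lemma choose_4: "real (n choose 4) * 24 = real n * (real n - 1) * (real n - 2) * (real n - 3)"
  by (simp add: binomial_gbinomial gbinomial_prod_rev eval_nat_numeral field_simps)

text \<open>The comparison holds factor by factor: \<open>(m - k) * n \<le> (n - k) * m\<close> for
  \<open>k\<close> from 0 to 3.\<close>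

lemma choose_4_ratio:
  assumes "4 \<le> m" "m \<le> n"
  shows "real (m choose 4) * real n ^ 4 \<le> real (n choose 4) * real m ^ 4"
proof -
  have nonneg: "0 \<le> (real m - k) * real n" if "k \<le> 3" for k :: real
    using assms that by (intro mult_nonneg_nonneg) auto
  have le: "(real m - k) * real n \<le> (real n - k) * real m" if "0 \<le> k" for k :: real
  proof -
    have "k * real m \<le> k * real n" using assms that by (simp add: mult_left_mono)
    then show ?thesis by (simp add: algebra_simps)
  qed
  have "(((real m - 0) * real n) * ((real m - 1) * real n)) * (((real m - 2) * real n) * ((real m - 3) * real n))
      \<le> (((real n - 0) * real m) * ((real n - 1) * real m)) * (((real n - 2) * real m) * ((real n - 3) * real m))"
    by (intro mult_mono' mult_nonneg_nonneg[of "_ * _" "_ * _"] le nonneg) simp_all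
  then have "(real (m choose 4) * 24) * real n ^ 4 \<le> (real (n choose 4) * 24) * real m ^ 4"
    unfolding choose_4 by (simp add: power4_eq_xxxx algebra_simps)
  then show ?thesis by simp
qed

text \<open>Double counting of the crossings inside subsets of size \<open>3 * h\<close>: each
  subset contains at least \<open>h\<close> of them, while a crossing has four distinct ends and so
  lies in \<open>(card V - 4) choose (3 * h - 4)\<close> subsets.\<close>

lemma card_crossings_ge_fraction:
  fixes G :: "'a ugraph"
  assumes "h \<ge> 2" "complete_minor_free h G" "finite V" "3 * h \<le> card V"
    and path: "\<And>u v. u \<in> V \<Longrightarrow> v \<in> V \<Longrightarrow> u \<noteq> v \<Longrightarrow> f {u, v} \<in> paths_between G u v"
  shows "real h * real (card V) ^ 4 \<le> real (card (crossings f V)) * real (3 * h) ^ 4"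
proof -
  let ?n = "card V" and ?m = "3 * h" and ?c = "card (crossings f V)"
  let ?\<S> = "{S. S \<subseteq> V \<and> card S = ?m}"
  have fin: "finite ?\<S>" using assms(3) by simp
  have "h * (?n choose ?m) = (\<Sum>S\<in>?\<S>. h)"
    using n_subsets[OF assms(3)] by simp
  also have "\<dots> \<le> (\<Sum>S\<in>?\<S>. card (crossings f S))"
  proof (rule sum_mono)
    fix S assume "S \<in> ?\<S>"
    then have S: "S \<subseteq> V" "card S = 3 * h" by auto
    then have "card S < card (crossings f S) + 2 * h"
      using assms(3) finite_subset path by (intro card_crossings_ge[OF assms(1,2)]) blast+
    then show "h \<le> card (crossings f S)" using S by simp
  qed
  also have "\<dots> = (\<Sum>S\<in>?\<S>. \<Sum>x\<in>crossings f V. if fst x \<union> snd x \<subseteq> S then 1 else 0)"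
  proof (rule sum.cong)
    fix S assume "S \<in> ?\<S>"
    then have "crossings f S = {x \<in> crossings f V. fst x \<union> snd x \<subseteq> S}"
      by (auto simp: crossings_def)
    then show "card (crossings f S) = (\<Sum>x\<in>crossings f V. if fst x \<union> snd x \<subseteq> S then 1 else 0)"
      using finite_crossings[OF assms(3)] by (simp add: sum.If_cases Int_def)
  qed simp
  also have "\<dots> = (\<Sum>x\<in>crossings f V. \<Sum>S\<in>?\<S>. if fst x \<union> snd x \<subseteq> S then 1 else 0)"
    by (rule sum.swap)
  also have "\<dots> = (\<Sum>x\<in>crossings f V. (?n - 4) choose (?m - 4))"
  proof (rule sum.cong)
    fix x assume "x \<in> crossings f V"
    then obtain e e' where x: "x = (e, e')" "e \<subseteq> V" "e' \<subseteq> V" "card e = 2" "card e' = 2" "e \<inter> e' = {}"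
      by (auto simp: crossings_def)
    have "finite e" "finite e'" using x assms(3) finite_subset by blast+
    then have "card (e \<union> e') = 4" using x by (simp add: card_Un_disjoint)
    moreover have "(\<Sum>S\<in>?\<S>. if e \<union> e' \<subseteq> S then 1 else 0) =
        card {S. S \<subseteq> V \<and> card S = ?m \<and> e \<union> e' \<subseteq> S}"
      using fin by (simp add: sum.If_cases Int_def conj_assoc)
    ultimately show "(\<Sum>S\<in>?\<S>. if fst x \<union> snd x \<subseteq> S then 1 else 0) = (?n - 4) choose (?m - 4)"
      using card_subsets_containing[OF assms(3), of "e \<union> e'" ?m] x assms(1) by simp
  qed simp
  finally have count: "h * (?n choose ?m) \<le> ?c * ((?n - 4) choose (?m - 4))" by simp
  let ?k = "(?n - 4) choose (?m - 4)"
  \<comment> \<open>Counting 4-subsets inside \<open>?m\<close>-subsets in two ways, as in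
    \<open>choose_mult\<close>, makes the factor \<open>?k\<close> common to both sides.\<close>
  have "(h * (?n choose 4)) * ?k = h * ((?n choose ?m) * (?m choose 4))"
    using choose_mult[of 4 ?m ?n] assms(1,4) by (simp add: mult.assoc)
  also have "\<dots> \<le> (?c * ?k) * (?m choose 4)"
    using mult_right_mono[OF count, of "?m choose 4"] by (simp only: mult.assoc)
  also have "\<dots> = (?c * (?m choose 4)) * ?k"
    by (simp only: mult_ac)
  finally have "(h * (?n choose 4)) * ?k \<le> (?c * (?m choose 4)) * ?k" .
  moreover have "(?n - 4) choose (?m - 4) > 0"
    using assms(4) by (intro zero_less_binomial) simp
  ultimately have le: "h * (?n choose 4) \<le> ?c * (?m choose 4)"
    using mult_le_cancel2 by blast
  have "real (?m choose 4) * (real h * real ?n ^ 4) \<le> real h * (real (?n choose 4) * real ?m ^ 4)"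
    using mult_left_mono[OF choose_4_ratio[of ?m ?n], of "real h"] assms(1,4) by (simp add: mult_ac)
  also have "\<dots> = real (h * (?n choose 4)) * real ?m ^ 4" by simp
  also have "\<dots> \<le> real (?c * (?m choose 4)) * real ?m ^ 4"
    using le by (intro mult_right_mono) (simp_all only: of_nat_le_iff zero_le_power of_nat_0_le_iff)
  also have "\<dots> = real (?m choose 4) * (real ?c * real ?m ^ 4)" by simp
  finally have "real (?m choose 4) * (real h * real ?n ^ 4) \<le> real (?m choose 4) * (real ?c * real ?m ^ 4)" .
  moreover have "?m choose 4 > 0" using assms(1) by (intro zero_less_binomial) simp
  ultimately show ?thesis by (simp only: mult_le_cancel_left_pos of_nat_0_less_iff)
qed

section \<open>Choosing paths by conditional expectations\<close>

lemma exists_le_weighted_mean: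
  fixes w g :: "'p \<Rightarrow> real"
  assumes "finite P" "\<And>p. p \<in> P \<Longrightarrow> 0 \<le> w p" "sum w P = 1"
  shows "\<exists>p\<in>P. g p \<le> (\<Sum>p\<in>P. w p * g p)"
proof (rule ccontr)
  let ?m = "\<Sum>p\<in>P. w p * g p"
  assume "\<not> ?thesis"
  then have gt: "?m < g p" if "p \<in> P" for p using that by (simp add: not_le)
  obtain p where p: "p \<in> P" "w p \<noteq> 0" using assms(3) by (metis sum.neutral zero_neq_one)
  have "?m = (\<Sum>p\<in>P. w p * ?m)" using assms(3) by (simp flip: sum_distrib_right)
  also have "\<dots> < ?m"
  proof (rule sum_strict_mono_ex1[OF assms(1)])
    show "\<forall>p\<in>P. w p * ?m \<le> w p * g p"
      using assms(2) gt by (intro ballI mult_left_mono) (auto intro: less_imp_le)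
    show "\<exists>p\<in>P. w p * ?m < w p * g p"
    proof (intro bexI[of _ p] mult_strict_left_mono)
      show "0 < w p" using assms(2)[OF p(1)] p(2) by simp
    qed (use p(1) gt in auto)
  qed
  finally show False by simp
qed

text \<open>The linear term makes the induction work: it collects the interaction of the remaining indices
  with the choices made so far.\<close>

lemma exists_choice_le_expectation_aux:
  fixes w :: "'e \<Rightarrow> 'p \<Rightarrow> real" and a :: "'e \<Rightarrow> 'p \<Rightarrow> real"
    and c :: "'e \<Rightarrow> 'p \<Rightarrow> 'e \<Rightarrow> 'p \<Rightarrow> real"
  assumes "finite E" and P: "\<And>e. e \<in> E \<Longrightarrow> finite (P e)"
    and w: "\<And>e p. e \<in> E \<Longrightarrow> p \<in> P e \<Longrightarrow> 0 \<le> w e p" "\<And>e. e \<in> E \<Longrightarrow> sum (w e) (P e) = 1"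
    and "\<And>e p q. e \<in> E \<Longrightarrow> c e p e q = 0"
  shows "\<exists>f. (\<forall>e\<in>E. f e \<in> P e) \<and>
    (\<Sum>e\<in>E. a e (f e)) + (\<Sum>e\<in>E. \<Sum>e'\<in>E. c e (f e) e' (f e')) \<le>
    (\<Sum>e\<in>E. \<Sum>p\<in>P e. w e p * a e p) +
    (\<Sum>e\<in>E. \<Sum>e'\<in>E. \<Sum>p\<in>P e. \<Sum>q\<in>P e'. w e p * w e' q * c e p e' q)"
  using assms
proof (induction E arbitrary: a rule: finite_induct)
  case (insert x E)
  \<comment> \<open>The diagonal has to vanish because the right side treats two occurrences of one
    index as independent, whereas a choice uses the same path twice.\<close>
  have diag: "c x p x q = 0" for p q using insert.prems(4) by simp
  \<comment> \<open>The conditional expectation of all terms involving \<open>x\<close> once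
    \<open>p\<close> is chosen there; both orders of each pair count.\<close>
  define g where "g p = a x p + (\<Sum>e\<in>E. \<Sum>q\<in>P e. w e q * (c x p e q + c e q x p))" for p
  obtain p where p: "p \<in> P x" "g p \<le> (\<Sum>p\<in>P x. w x p * g p)"
    using exists_le_weighted_mean[of "P x" "w x" g] insert.prems by auto
  define b where "b e q = a e q + (c x p e q + c e q x p)" for e q
  obtain f where f: "\<forall>e\<in>E. f e \<in> P e" and le:
    "(\<Sum>e\<in>E. b e (f e)) + (\<Sum>e\<in>E. \<Sum>e'\<in>E. c e (f e) e' (f e')) \<le>
    (\<Sum>e\<in>E. \<Sum>p\<in>P e. w e p * b e p) +
    (\<Sum>e\<in>E. \<Sum>e'\<in>E. \<Sum>p\<in>P e. \<Sum>q\<in>P e'. w e p * w e' q * c e p e' q)"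
    using insert.IH[of b] insert.prems by auto
  let ?f = "f(x := p)"
  let ?X = "\<Sum>e\<in>E. \<Sum>e'\<in>E. c e (f e) e' (f e')"
  let ?Y = "\<Sum>e\<in>E. \<Sum>e'\<in>E. \<Sum>p\<in>P e. \<Sum>q\<in>P e'. w e p * w e' q * c e p e' q"
  let ?A = "\<Sum>e\<in>E. \<Sum>p\<in>P e. w e p * a e p"
  have fx: "?f x = p" by simp
  have fE: "?f e = f e" if "e \<in> E" for e using that insert.hyps(2) by auto
  have "(\<Sum>e\<in>insert x E. a e (?f e)) + (\<Sum>e\<in>insert x E. \<Sum>e'\<in>insert x E. c e (?f e) e' (?f e'))
      = a x p + (\<Sum>e\<in>E. a e (f e)) + ((\<Sum>e\<in>E. c x p e (f e)) + (\<Sum>e\<in>E. c e (f e) x p + (\<Sum>e'\<in>E. c e (f e) e' (f e'))))"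
    using insert.hyps by (simp add: diag fE fx del: fun_upd_apply cong: sum.cong)
  also have "\<dots> = a x p + (\<Sum>e\<in>E. b e (f e)) + ?X"
    by (simp add: b_def sum.distrib)
  also have "\<dots> \<le> a x p + ((\<Sum>e\<in>E. \<Sum>p\<in>P e. w e p * b e p) + ?Y)"
    using le by simp
  also have "\<dots> = g p + ?A + ?Y"
    by (simp add: b_def g_def sum.distrib distrib_left)
  also have "\<dots> \<le> (\<Sum>p\<in>P x. w x p * g p) + ?A + ?Y"
    using p(2) by simp
  also have "(\<Sum>p\<in>P x. w x p * g p) = (\<Sum>p\<in>P x. w x p * a x p) +
      ((\<Sum>e\<in>E. \<Sum>p\<in>P x. \<Sum>q\<in>P e. w x p * w e q * c x p e q) +
       (\<Sum>e\<in>E. \<Sum>p\<in>P e. \<Sum>q\<in>P x. w e p * w x q * c e p x q))"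
  proof -
    have 1: "(\<Sum>p\<in>P x. w x p * (\<Sum>e\<in>E. \<Sum>q\<in>P e. w e q * c x p e q)) =
        (\<Sum>e\<in>E. \<Sum>p\<in>P x. \<Sum>q\<in>P e. w x p * w e q * c x p e q)"
      by (simp add: sum_distrib_left mult.assoc sum.swap[of _ E])
    have 2: "(\<Sum>p\<in>P x. w x p * (\<Sum>e\<in>E. \<Sum>q\<in>P e. w e q * c e q x p)) =
        (\<Sum>e\<in>E. \<Sum>p\<in>P e. \<Sum>q\<in>P x. w e p * w x q * c e p x q)"
    proof -
      have "(\<Sum>p\<in>P x. w x p * (\<Sum>e\<in>E. \<Sum>q\<in>P e. w e q * c e q x p)) =
          (\<Sum>e\<in>E. \<Sum>q\<in>P x. \<Sum>p\<in>P e. w e p * w x q * c e p x q)"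
        by (simp add: sum_distrib_left mult_ac sum.swap[of _ E])
      then show ?thesis by (simp add: sum.swap[of _ "P x"])
    qed
    show ?thesis
      unfolding g_def 1[symmetric] 2[symmetric] by (simp add: sum.distrib distrib_left)
  qed
  finally have "(\<Sum>e\<in>insert x E. a e (?f e)) +
      (\<Sum>e\<in>insert x E. \<Sum>e'\<in>insert x E. c e (?f e) e' (?f e')) \<le>
      (\<Sum>e\<in>insert x E. \<Sum>p\<in>P e. w e p * a e p) +
      (\<Sum>e\<in>insert x E. \<Sum>e'\<in>insert x E. \<Sum>p\<in>P e. \<Sum>q\<in>P e'. w e p * w e' q * c e p e' q)"
    using insert.hyps by (simp add: diag sum.distrib)
  moreover have "\<forall>e\<in>insert x E. ?f e \<in> P e" using f p(1) by auto
  ultimately show ?case by blast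
qed simp

lemma exists_choice_le_expectation:
  fixes w :: "'e \<Rightarrow> 'p \<Rightarrow> real" and c :: "'e \<Rightarrow> 'p \<Rightarrow> 'e \<Rightarrow> 'p \<Rightarrow> real"
  assumes "finite E" "\<And>e. e \<in> E \<Longrightarrow> finite (P e)"
    and "\<And>e p. e \<in> E \<Longrightarrow> p \<in> P e \<Longrightarrow> 0 \<le> w e p" "\<And>e. e \<in> E \<Longrightarrow> sum (w e) (P e) = 1"
    and "\<And>e p q. e \<in> E \<Longrightarrow> c e p e q = 0"
  shows "\<exists>f. (\<forall>e\<in>E. f e \<in> P e) \<and> (\<Sum>e\<in>E. \<Sum>e'\<in>E. c e (f e) e' (f e')) \<le>
    (\<Sum>e\<in>E. \<Sum>e'\<in>E. \<Sum>p\<in>P e. \<Sum>q\<in>P e'. w e p * w e' q * c e p e' q)"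
  using exists_choice_le_expectation_aux[where a = "\<lambda>_ _. 0" and E = E and P = P and w = w and c = c] assms
  by simp

text \<open>The ends of a path are its vertices on at most one edge, hence determined by the subgraph.\<close>

lemma path_graph_ends:
  assumes "distinct xs" "xs \<noteq> []"
  shows "{x \<in> vertices (path_graph xs). \<forall>e\<in>edges (path_graph xs). \<forall>e'\<in>edges (path_graph xs).
    x \<in> e \<longrightarrow> x \<in> e' \<longrightarrow> e = e'} = {hd xs, last xs}" (is "?L = _")
proof -
  let ?n = "length xs"
  let ?e = "\<lambda>i. {xs ! i, xs ! Suc i}"
  have idx: "xs ! i = xs ! j \<longleftrightarrow> i = j" if "i < ?n" "j < ?n" for i j
    using assms(1) that by (simp add: nth_eq_iff_index_eq)
  have mem: "xs ! k \<in> ?e i \<longleftrightarrow> k = i \<or> k = Suc i" if "k < ?n" "Suc i < ?n" for k i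
    using idx that by auto
  have "xs ! k \<in> ?L \<longleftrightarrow> k = 0 \<or> Suc k = ?n" if k: "k < ?n" for k
  proof
    assume L: "xs ! k \<in> ?L"
    show "k = 0 \<or> Suc k = ?n"
    proof (rule ccontr)
      assume "\<not> ?thesis"
      then obtain l where l: "k = Suc l" "Suc k < ?n" using k by (metis Suc_lessI not0_implies_Suc)
      have "?e l \<in> edges (path_graph xs)" "?e k \<in> edges (path_graph xs)"
        using l by (auto simp: path_graph_def)
      then have "?e l = ?e k" using L l by auto
      then have "xs ! l \<in> ?e k" by blast
      then show False using mem[of l k] l by simp
    qed
  next
    assume k': "k = 0 \<or> Suc k = ?n"
    have "e = ?e (if k = 0 then 0 else k - 1)"
      if e: "e \<in> edges (path_graph xs)" "xs ! k \<in> e" for e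
    proof -
      obtain i where i: "e = ?e i" "Suc i < ?n" using e(1) by (auto simp: path_graph_def)
      then have "k = i \<or> k = Suc i" using mem[of k i] k e(2) by simp
      then show ?thesis using k' i by auto
    qed
    then have "e = e'" if "e \<in> edges (path_graph xs)" "e' \<in> edges (path_graph xs)" "xs ! k \<in> e" "xs ! k \<in> e'"
      for e e' using that by metis
    moreover have "xs ! k \<in> vertices (path_graph xs)" using k by (simp add: path_graph_def)
    ultimately show "xs ! k \<in> ?L" by blast
  qed
  note ends = this
  have n: "0 < ?n" using assms(2) by simp
  have hl: "hd xs = xs ! 0" "last xs = xs ! (?n - 1)"
    using assms(2) by (simp_all add: hd_conv_nth last_conv_nth)
  show ?thesis
  proof (rule equalityI)
    show "?L \<subseteq> {hd xs, last xs}"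
    proof
      fix x assume x: "x \<in> ?L"
      then have "x \<in> set xs" by (simp add: path_graph_def)
      then obtain k where k: "k < ?n" "x = xs ! k" by (metis in_set_conv_nth)
      then have "k = 0 \<or> Suc k = ?n" using ends[OF k(1)] x by simp
      then show "x \<in> {hd xs, last xs}" using hl k(2) by (metis diff_Suc_1 insertCI)
    qed
    show "{hd xs, last xs} \<subseteq> ?L"
      using ends[of 0] ends[of "?n - 1"] n unfolding hl by simp
  qed
qed

text \<open>Makes the path sets of different vertex pairs disjoint, so that the flow on a path is
  charged to one pair only.\<close>

lemma paths_between_ends:
  assumes "p \<in> paths_between G u v" "p \<in> paths_between G u' v'"
  shows "{u, v} = {u', v'}"
proof -
  obtain xs where xs: "p = path_graph xs" "vertex_path G xs" "hd xs = u" "last xs = v"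
    using assms(1) by (auto simp: paths_between_def)
  obtain ys where ys: "p = path_graph ys" "vertex_path G ys" "hd ys = u'" "last ys = v'"
    using assms(2) by (auto simp: paths_between_def)
  show ?thesis
    using path_graph_ends[of xs] path_graph_ends[of ys] xs ys by (simp add: vertex_path_def)
qed

text \<open>For every pair of vertices a path \<open>p\<close> is drawn independently with
  probability \<open>F p\<close>. Crossing paths share a vertex, and the products
  \<open>F p * F q\<close> over pairs of paths through \<open>v\<close> add up to at most the
  squared congestion at \<open>v\<close>. Some choice is no worse than the expectation.\<close>

lemma exists_integral_flow:
  fixes G :: "'a ugraph"
  assumes "finite (vertices G)" "unit_complete_flow G F"
  shows "\<exists>f. (\<forall>u\<in>vertices G. \<forall>v\<in>vertices G. u \<noteq> v \<longrightarrow> f {u, v} \<in> paths_between G u v) \<and>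
    real (card (crossings f (vertices G))) \<le> (con2 G F)\<^sup>2"
proof -
  let ?V = "vertices G"
  define E where "E = {e. e \<subseteq> ?V \<and> card e = 2}"
  define P where "P e = {p. \<exists>u v. e = {u, v} \<and> p \<in> paths_between G u v}" for e
  define c where "c e p e' q = (of_bool (e \<inter> e' = {} \<and> vertices p \<inter> vertices q \<noteq> {}) :: real)"
    for e e' :: "'a set" and p q :: "'a ugraph"
  have P_eq: "P {u, v} = paths_between G u v" for u v
    using paths_between_commute[of G] by (auto simp: P_def doubleton_eq_iff)
  have E_elim: "\<exists>u\<in>?V. \<exists>v\<in>?V. u \<noteq> v \<and> e = {u, v}" if "e \<in> E" for e
    using that by (auto simp: E_def card_2_iff)
  have P_sub: "P e \<subseteq> paths G" if e: "e \<in> E" for e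
  proof -
    obtain u v where "u \<in> ?V" "v \<in> ?V" "e = {u, v}" using E_elim[OF e] by blast
    then show ?thesis unfolding paths_def using P_eq[of u v] by blast
  qed
  have finE: "finite E" using assms(1) by (simp add: E_def)
  have finP: "finite (P e)" if "e \<in> E" for e
    using P_sub[OF that] finite_paths[OF assms(1)] finite_subset by blast
  have F0: "0 \<le> F p" if "p \<in> paths G" for p
    using assms(2) that by (simp add: unit_complete_flow_def is_flow_def)
  have F1: "sum F (P e) = 1" if "e \<in> E" for e
    using E_elim[OF that] P_eq assms(2) by (auto simp: unit_complete_flow_def)
  have P_disj: "P e \<inter> P e' = {}" if "e \<noteq> e'" for e e'
  proof -
    have "e = e'" if p: "p \<in> P e" "p \<in> P e'" for p
    proof -
      obtain u v u' v' where "e = {u, v}" "e' = {u', v'}"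
          "p \<in> paths_between G u v" "p \<in> paths_between G u' v'"
        using p unfolding P_def by blast
      then show ?thesis using paths_between_ends by metis
    qed
    then show ?thesis using that by blast
  qed
  \<comment> \<open>A two-element set is never disjoint from itself, which gives the vanishing
    diagonal required for the choice.\<close>
  have c0: "c e p e q = 0" if "e \<in> E" for e p q
    using that by (auto simp: c_def E_def)
  let ?in = "\<lambda>v p. of_bool (v \<in> vertices p) :: real"
  \<comment> \<open>Only an inequality, since the congestion also counts single-vertex paths, which
    join no pair in \<open>E\<close>.\<close>
  have cong: "(\<Sum>e\<in>E. \<Sum>p\<in>P e. F p * ?in v p) \<le> vertex_congestion G F v" for v
  proof -
    have "(\<Sum>e\<in>E. \<Sum>p\<in>P e. F p * ?in v p) = (\<Sum>p\<in>(\<Union>e\<in>E. P e). F p * ?in v p)"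
      using finE finP P_disj by (subst sum.UNION_disjoint) auto
    also have "\<dots> \<le> (\<Sum>p\<in>paths G. F p * ?in v p)"
      using P_sub F0 finite_paths[OF assms(1)] by (intro sum_mono2) auto
    also have "\<dots> = vertex_congestion G F v"
      using finite_paths[OF assms(1)] by (simp add: vertex_congestion_def sum.inter_filter of_bool_def if_distrib cong: if_cong)
    finally show ?thesis .
  qed
  have "(\<Sum>e\<in>E. \<Sum>e'\<in>E. \<Sum>p\<in>P e. \<Sum>q\<in>P e'. F p * F q * c e p e' q) \<le>
      (\<Sum>e\<in>E. \<Sum>e'\<in>E. \<Sum>p\<in>P e. \<Sum>q\<in>P e'. F p * F q * (\<Sum>v\<in>?V. ?in v p * ?in v q))"
  proof (intro sum_mono mult_left_mono)
    fix e e' p q assume e: "e \<in> E" "e' \<in> E" "p \<in> P e" "q \<in> P e'"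
    then have pq: "p \<in> paths G" "q \<in> paths G" using P_sub by auto
    then show "0 \<le> F p * F q" using F0 by simp
    have pV: "vertices p \<subseteq> ?V"
      using pq(1) by (auto simp: paths_def paths_between_def path_graph_def vertex_path_def)
    show "c e p e' q \<le> (\<Sum>v\<in>?V. ?in v p * ?in v q)"
    proof (cases "vertices p \<inter> vertices q = {}")
      case True
      then show ?thesis by (simp add: c_def sum_nonneg)
    next
      case False
      then obtain v where v: "v \<in> vertices p" "v \<in> vertices q" by blast
      have "c e p e' q \<le> ?in v p * ?in v q" using v by (simp add: c_def)
      also have "\<dots> \<le> (\<Sum>v\<in>?V. ?in v p * ?in v q)"
        using assms(1) pV v by (intro member_le_sum) auto
      finally show ?thesis .
    qed
  qed
  also have "\<dots> = (\<Sum>v\<in>?V. (\<Sum>e\<in>E. \<Sum>p\<in>P e. F p * ?in v p)\<^sup>2)"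
  proof -
    have "(\<Sum>e\<in>E. \<Sum>p\<in>P e. F p * ?in v p)\<^sup>2 =
        (\<Sum>e\<in>E. \<Sum>e'\<in>E. \<Sum>p\<in>P e. \<Sum>q\<in>P e'. F p * F q * (?in v p * ?in v q))" for v
      unfolding power2_eq_square sum_product by (intro sum.cong refl) (simp only: mult_ac)
    then show ?thesis
      by (simp only: sum_distrib_left sum.swap[of _ ?V])
  qed
  also have "\<dots> \<le> (\<Sum>v\<in>?V. (vertex_congestion G F v)\<^sup>2)"
  proof (intro sum_mono power_mono cong sum_nonneg)
    fix e p assume "e \<in> E" "p \<in> P e"
    then have "0 \<le> F p" using F0 P_sub by blast
    then show "0 \<le> F p * of_bool (v \<in> vertices p)" for v by simp
  qed
  also have "\<dots> = (con2 G F)\<^sup>2" by (simp add: con2_def sum_nonneg)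
  finally have bound: "(\<Sum>e\<in>E. \<Sum>e'\<in>E. \<Sum>p\<in>P e. \<Sum>q\<in>P e'. F p * F q * c e p e' q) \<le> (con2 G F)\<^sup>2" .
  have "\<exists>f. (\<forall>e\<in>E. f e \<in> P e) \<and> (\<Sum>e\<in>E. \<Sum>e'\<in>E. c e (f e) e' (f e')) \<le>
      (\<Sum>e\<in>E. \<Sum>e'\<in>E. \<Sum>p\<in>P e. \<Sum>q\<in>P e'. F p * F q * c e p e' q)"
  proof (rule exists_choice_le_expectation)
    show "0 \<le> F p" if "e \<in> E" "p \<in> P e" for e p using F0 P_sub that by blast
  qed (fact finE finP F1 c0)+
  then obtain f where f: "\<And>e. e \<in> E \<Longrightarrow> f e \<in> P e"
    and f_le: "(\<Sum>e\<in>E. \<Sum>e'\<in>E. c e (f e) e' (f e')) \<le>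
      (\<Sum>e\<in>E. \<Sum>e'\<in>E. \<Sum>p\<in>P e. \<Sum>q\<in>P e'. F p * F q * c e p e' q)"
    by blast
  let ?Q = "\<lambda>x. fst x \<inter> snd x = {} \<and> vertices (f (fst x)) \<inter> vertices (f (snd x)) \<noteq> {}"
  have "crossings f ?V = E \<times> E \<inter> {x. ?Q x}"
    unfolding crossings_def E_def by auto
  then have "real (card (crossings f ?V)) = (\<Sum>x\<in>E \<times> E. of_bool (?Q x))"
    using finE by (simp add: sum_of_bool_eq)
  also have "\<dots> = (\<Sum>x\<in>E \<times> E. c (fst x) (f (fst x)) (snd x) (f (snd x)))"
    by (simp add: c_def)
  also have "\<dots> = (\<Sum>e\<in>E. \<Sum>e'\<in>E. c e (f e) e' (f e'))"
    by (simp add: sum.cartesian_product case_prod_beta)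
  finally have "real (card (crossings f ?V)) \<le> (con2 G F)\<^sup>2" using f_le bound by simp
  moreover have "f {u, v} \<in> paths_between G u v" if "u \<in> ?V" "v \<in> ?V" "u \<noteq> v" for u v
    using f[of "{u, v}"] that by (simp add: E_def P_eq)
  ultimately show ?thesis by blast
qed

text \<open>A single vertex is a branch set for \<open>K_1\<close>, and \<open>K_0\<close> needs
  none. Hence excluding \<open>K_h\<close> as a minor of a nonempty graph forces
  \<open>h \<ge> 2\<close>.\<close>

lemma complete_minor_1:
  fixes h :: nat
  assumes "v \<in> vertices G" "h \<le> 1"
  shows "is_minor (complete_graph {..<h}) G"
proof -
  have "connected_set G {v}" using assms(1) by (simp add: connected_set_def)
  then have "connected_graph (induced_subgraph G {v})" by (rule connected_graph_induced)
  moreover have eq: "x = y" if "x < h" "y < h" for x y using that assms(2) by simp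
  then have "edges (complete_graph {..<h}) = {}" by (auto simp: complete_graph_def)
  moreover have "vertices (complete_graph {..<h}) = {..<h}" by (simp add: complete_graph_def)
  ultimately show ?thesis
    using assms(1) eq unfolding is_minor_def by (intro exI[of _ "\<lambda>_. {v}"]) auto
qed

theorem theorem3p9:
  fixes G :: "'a ugraph" and F :: "'a ugraph \<Rightarrow> real" and h n :: nat
  assumes "simple_graph G"
    and "complete_minor_free h G"
    and "n = card (vertices G)"
    and "unit_complete_flow G F"
    and "n \<ge> 4 * h"
  shows "con2 G F \<ge> real n ^ 2 / (12 * real h powr (3 / 2))"
proof (cases "n = 0")
  case True
  then show ?thesis by (simp add: con2_def sum_nonneg)
next
  case False
  have fin: "finite (vertices G)" using assms(1) by (simp add: simple_graph_def)
  obtain v where "v \<in> vertices G" using False assms(3) by fastforce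
  then have h: "h \<ge> 2"
    using complete_minor_1[of v G h] assms(2) by (fastforce simp: complete_minor_free_def)
  obtain f where f: "\<forall>u\<in>vertices G. \<forall>v\<in>vertices G. u \<noteq> v \<longrightarrow> f {u, v} \<in> paths_between G u v"
    and le: "real (card (crossings f (vertices G))) \<le> (con2 G F)\<^sup>2"
    using exists_integral_flow[OF fin assms(4)] by blast
  have "real h * real n ^ 4 \<le> real (card (crossings f (vertices G))) * real (3 * h) ^ 4"
    using card_crossings_ge_fraction[OF h assms(2) fin, of f] f assms(3,5) by simp
  also have "\<dots> \<le> (con2 G F)\<^sup>2 * (real (3 * h)) ^ 4"
    using le by (intro mult_right_mono) auto
  finally have "real h * real n ^ 4 \<le> real h * ((con2 G F)\<^sup>2 * (81 * real h ^ 3))"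
    by (simp add: power_mult_distrib power4_eq_xxxx power3_eq_cube mult_ac)
  then have "real n ^ 4 \<le> (con2 G F)\<^sup>2 * (81 * real h ^ 3)"
    using h by simp
  \<comment> \<open>The factor 81 is the \<open>3 ^ 4\<close> from sampling \<open>3 * h\<close>
    vertices; it is relaxed to \<open>144 = 12 ^ 2\<close> to match the constant 12 of the
    bound.\<close>
  also have "\<dots> \<le> (con2 G F)\<^sup>2 * (144 * real h ^ 3)"
    by (intro mult_left_mono) auto
  finally have main: "real n ^ 4 \<le> (con2 G F)\<^sup>2 * (144 * real h ^ 3)" .
  have "(12 * real h powr (3 / 2))\<^sup>2 = 144 * real h ^ 3"
    by (simp add: power_mult_distrib power2_eq_square[of "_ powr _"] flip: powr_add)
  then have "(real n ^ 2)\<^sup>2 \<le> (con2 G F * (12 * real h powr (3 / 2)))\<^sup>2"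
    using main by (simp only: power_mult_distrib flip: power_mult) simp
  then have "real n ^ 2 \<le> con2 G F * (12 * real h powr (3 / 2))"
    by (rule power2_le_imp_le) (simp add: con2_def sum_nonneg)
  then show ?thesis
    using h by (simp add: divide_le_eq)
qed

end
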